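(* Let $\mathcal V$ be a category with a class $\mathcal C$ of confined morphisms, a class of independent squares, a class $\mathcal S$ of specialized maps and a fibered category $\mathcal L$ over $\mathcal V$. Let $\mathcal{OBT}$ be a class of oriented additive bivariant theories on $\mathcal V$ (with these data), and let $\mathcal S$ be nice canonically $\mathbb{OB}$-oriented for any $\mathbb{OB}\in\mathcal{OBT}$. Then for each $\mathbb{OB}\in\mathcal{OBT}$ with orientation $\phi$: (1) there exists a unique natural transformation of oriented Borel--Moore functors with products $${\gamma_{\mathbb{OB}}}_*:{\mathbb{OM}^{\mathcal C}_{\mathcal S}}_*\to\mathbb{OB}_*$$ such that if $\pi_X:X\to pt$ is in $\mathcal S$, then $${\gamma_{\mathbb{OB}}}_*[X\xrightarrow{\mathrm{id}_X}X;L_1,\dots,L_r]=\phi(L_1)\circ\cdots\circ\phi(L_r)(\pi_X^!(1_{pt}));$$ (2) there exists a unique natural transformation of oriented Borel--Moore functors with products $${\gamma_{\mathbb{OB}}}^*:{\mathbb{OM}^{\mathcal C}_{\mathcal S}}^*\to\mathbb{OB}^*$$ such that for any object $X$ $${\gamma_{\mathbb{OB}}}^*[X\xrightarrow{\mathrm{id}_X}X;L_1,\dots,L_r]=\phi(L_1)\circ\cdots\circ\phi(L_r)(1_X).$$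
   Context: **Category.** $\mathcal V$ has a final object $pt$ and fibre products. The class $\mathcal C$ of confined morphisms is closed under composition and base change and contains all identities. A fibre square is written with $f:X\to Y$ (right vertical), $g:Y'\to Y$ (bottom), $g':X'\to X$ (top), $f':X'\to Y'$ (left); it pulls $f$ back along $g$. A class of fibre squares, called independent, is given such that: (i) the outer square formed from two horizontally or vertically adjacent independent squares is independent; (ii) for every $f:X\to Y$ the square with both verticals $f$ and horizontals $\mathrm{id}_X,\mathrm{id}_Y$, and the square with both horizontals $f$ and verticals $\mathrm{id}_X,\mathrm{id}_Y$, are independent. Whenever exterior products are considered, all squares formed from products of morphisms, $X\times Y\to X'\times Y$ over $X\times Y'\to X'\times Y'$ (including $X'=pt$ or $Y'=pt$), are assumed independent, in both ways of drawing them. **Bivariant theory.** A bivariant theory $\mathbb B$ on $\mathcal V$ assigns to each morphism $f:X\to Y$ a (graded; the grading may be ignored) abelian group $\mathbb B(X\xrightarrow{f}Y)$ with products $\bullet:\mathbb B(X\xrightarrow{f}Y)\otimes\mathbb B(Y\xrightarrow{g}Z)\to\mathbb B(X\xrightarrow{gf}Z)$; pushforwards $f_*:\mathbb B(X\xrightarrow{gf}Z)\to\mathbb B(Y\xrightarrow{g}Z)$ for $f$ confined; pullbacks $g^*:\mathbb B(X\xrightarrow{f}Y)\to\mathbb B(X'\xrightarrow{f'}Y')$ for each independent square; subject to: (B-1) $\bullet$ is associative; (B-2) pushforward is functorial; (B-3) pullback is functorial (for horizontally adjacent independent squares); (B-4) $f_*(\alpha\bullet\beta)=f_*\alpha\bullet\beta$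 for $X\xrightarrow{f}Y\xrightarrow{g}Z\xrightarrow{h}W$, $f$ confined, $\alpha\in\mathbb B(gf)$, $\beta\in\mathbb B(h)$; (B-5) $h^*(\alpha\bullet\beta)=h'^*\alpha\bullet h^*\beta$ for $\alpha\in\mathbb B(X\xrightarrow{f}Y)$, $\beta\in\mathbb B(Y\xrightarrow{g}Z)$ and vertically stacked independent squares pulling $g$ back along $h:Z'\to Z$ and $f$ back along the induced $h':Y'\to Y$; (B-6) $f'_*(h^*\alpha)=h^*(f_*\alpha)$ for such stacked squares with $f$ confined, $\alpha\in\mathbb B(X\xrightarrow{gf}Z)$; (B-7) $g'_*(g^*\alpha\bullet\beta)=\alpha\bullet g_*\beta$ for an independent square with $g$ confined, $\alpha\in\mathbb B(X\xrightarrow{f}Y)$, $\beta\in\mathbb B(Y'\xrightarrow{hg}Z)$, $h:Y\to Z$; and units: $1_X\in\mathbb B(X\xrightarrow{\mathrm{id}}X)$ with $\alpha\bullet1_X=\alpha$, $1_X\bullet\beta=\beta$, $g^*1_X=1_{X'}$ for all $g:X'\to X$. All bivariant theories are assumed commutative: for $f:X\to Z$, $g:Y\to Z$ such that the fibre square of $f,g$ is independent both as a square pulling $f$ back along $g$ and as one pulling $g$ back along $f$, $g^*\alpha\bullet\beta=f^*\beta\bullet\alpha$ for $\alpha\in\mathbb B(f)$, $\beta\in\mathbb B(g)$. **Specialized maps and orientations.** $\mathcal S$ is a class of morphisms (specialized) closed under composition and base change and containing all identities. $\mathcal S$ is nice canonically $\mathbb B$-oriented if to each $f:X\to Y$ in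 $\mathcal S$ there is assigned $\theta_{\mathbb B}(f)\in\mathbb B(X\xrightarrow{f}Y)$ with $\theta_{\mathbb B}(g\circ f)=\theta_{\mathbb B}(f)\bullet\theta_{\mathbb B}(g)$, $\theta_{\mathbb B}(\mathrm{id}_X)=1_X$, and $\theta_{\mathbb B}(f')=g^*\theta_{\mathbb B}(f)$ for every independent square with $f\in\mathcal S$. **Associated functors.** $\mathbb B_*(X)=\mathbb B(X\to pt)$, covariant for confined morphisms via $f_*$, with Gysin maps $f^!:\mathbb B_*(Y)\to\mathbb B_*(X)$, $f^!(\alpha)=\theta_{\mathbb B}(f)\bullet\alpha$ for $f:X\to Y$ in $\mathcal S$. $\mathbb B^*(X)=\mathbb B(X\xrightarrow{\mathrm{id}}X)$, contravariant for all morphisms via $f^*$, with Gysin maps $f_!:\mathbb B^*(X)\to\mathbb B^*(Y)$, $f_!(\alpha)=f_*(\alpha\bullet\theta_{\mathbb B}(f))$ for $f\in\mathcal C\cap\mathcal S$. Exterior products: $\alpha\times\beta=\pi_Y^*\alpha\bullet\beta$ on $\mathbb B_*$ (with $\pi_Y:Y\to pt$), $\alpha\times\beta=p_1^*\alpha\bullet p_2^*\beta$ on $\mathbb B^*$ (with $p_1,p_2$ the projections of $X\times Y$). **Additivity.** When additive theories are considered it is assumed that: (1) $\mathcal V$ is closed under coproducts $\coprod$; (2) $i_X:X\to X\coprod Y$ and $i_Y:Y\to X\coprod Y$ are confined, nice canonically $\mathbb B$-oriented and strongly oriented (i.e. for all $g:W\to X$, $\bullet\,\theta_{\mathbb B}(i_X):\mathbb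 B(W\xrightarrow{g}X)\to\mathbb B(W\xrightarrow{i_Xg}X\coprod Y)$ is an isomorphism, and likewise for $i_Y$); (3) $f:X\coprod Y\to Z$ is confined iff $f|_X=f\circ i_X$ and $f|_Y=f\circ i_Y$ are; (4) $\mathcal C$-independence: every fibre square in which one of the two morphisms to the common target (drawn as right vertical or as bottom arrow) is confined is independent. $\mathbb B$ is additive if ${i_X}_*\oplus{i_Y}_*:\mathbb B(X\xrightarrow{f|_X}Z)\oplus\mathbb B(Y\xrightarrow{f|_Y}Z)\to\mathbb B(X\coprod Y\xrightarrow{f}Z)$ is always an isomorphism. **Oriented bivariant theory.** An object $L$ of the fibre $\mathcal L(X)$ is called a fiber-object over $X$; $f^*$ denotes pullback of fiber-objects. An oriented bivariant theory is a bivariant theory $\mathbb{OB}$ with, for every $f:X\to Y$ and fiber-object $L$ over $X$, an endomorphism $\phi(L)$ of $\mathbb{OB}(X\xrightarrow{f}Y)$ (the orientation) such that: (O-1) $\phi(L)=\phi(L')$ if $L\cong L'$; (O-2) $\phi(L)\circ\phi(L')=\phi(L')\circ\phi(L)$; (O-3) for $\alpha\in\mathbb{OB}(X\xrightarrow{f}Y)$, $\beta\in\mathbb{OB}(Y\xrightarrow{g}Z)$, $L$ over $X$, $M$ over $Y$: $\phi(L)(\alpha\bullet\beta)=\phi(L)(\alpha)\bullet\beta$ and $\phi(f^*M)(\alpha\bullet\beta)=\alpha\bullet\phi(M)(\beta)$; (O-4) for $f:X\to Y$ confined and $M$ over $Y$: $f_*(\phi(f^*M)(\alpha))=\phi(M)(f_*\alpha)$;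 (O-5) for an independent square and $L$ over $X$: $g^*(\phi(L)(\alpha))=\phi(g'^*L)(g^*\alpha)$. **The theory $\mathbb{OM}^{\mathcal C}_{\mathcal S}$.** A cobordism cycle over $X$ is a tuple $(V\xrightarrow{h}X;L_1,\dots,L_r)$, $r\ge0$, with $L_i$ fiber-objects over $V$; two, $(V\xrightarrow{h_V}X;L_\bullet)$ and $(W\xrightarrow{h_W}X;M_\bullet)$, are isomorphic if they have the same $r$ and there are an isomorphism $g:V\cong W$ over $X$, a permutation $\sigma$ and isomorphisms $L_i\cong g^*M_{\sigma(i)}$. $\mathbb{OM}^{\mathcal C}_{\mathcal S}(X\xrightarrow{f}Y)$ is the free abelian group on isomorphism classes $[V\xrightarrow{h}X;L_1,\dots,L_r]$ with $h\in\mathcal C$ and $f\circ h\in\mathcal S$. Operations: $\Phi(L)[V\xrightarrow{h}X;L_\bullet]=[V\xrightarrow{h}X;L_\bullet,h^*L]$; $f_*[V\xrightarrow{h}X;L_\bullet]=[V\xrightarrow{fh}Y;L_\bullet]$; $g^*[V\xrightarrow{h}X;L_\bullet]=[V'\xrightarrow{h'}X';g''^*L_\bullet]$ with $V'=V\times_XX'$ and projections $h',g''$; $[V\xrightarrow{h}X;L_\bullet]\bullet[W\xrightarrow{k}Y;M_\bullet]=[V'\xrightarrow{h\circ k''}X;k''^*L_\bullet,(f'h')^*M_\bullet]$ with $X'=X\times_YW$, $f':X'\to W$, $V'=V\times_XX'$, $h':V'\to X'$, $k'':V'\to V$. Its canonical orientation is $\theta(f)=[X\xrightarrow{\mathrm{id}}X]$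 for $f:X\to Y$ in $\mathcal S$. **Natural transformation of oriented Borel--Moore functors with products.** In (1): homomorphisms ${\mathbb{OM}^{\mathcal C}_{\mathcal S}}_*(X)\to\mathbb{OB}_*(X)$ for all $X$, compatible with $f_*$ for confined $f$, $f^!$ for $f\in\mathcal S$, exterior products, and the orientation operators $\Phi(L),\phi(L)$. In (2): homomorphisms ${\mathbb{OM}^{\mathcal C}_{\mathcal S}}^*(X)\to\mathbb{OB}^*(X)$ for all $X$, compatible with $f^*$ for all $f$, $f_!$ for $f\in\mathcal C\cap\mathcal S$, exterior products, and the orientation operators. *)

theory Defs
  imports "HOL-Algebra.Free_Abelian_Groups" "HOL-Combinatorics.Permutations"
begin

section \<open>Categories and fibre squares\<close>

record ('o, 'm) cat =
  Obj :: "'o set"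
  Arr :: "'m set"
  Dom :: "'m \<Rightarrow> 'o"
  Cod :: "'m \<Rightarrow> 'o"
  Idn :: "'o \<Rightarrow> 'm"
  Cmp :: "'m \<Rightarrow> 'm \<Rightarrow> 'm"  (infixl \<open>\<cdot>\<index>\<close> 70)

definition homset :: "('o, 'm, 'z) cat_scheme \<Rightarrow> 'o \<Rightarrow> 'o \<Rightarrow> 'm set"
  where "homset V X Y = {f \<in> Arr V. Dom V f = X \<and> Cod V f = Y}"

locale category =
  fixes V :: "('o, 'm, 'z) cat_scheme" (structure)
  assumes Dom_Obj: "f \<in> Arr V \<Longrightarrow> Dom V f \<in> Obj V"
    and Cod_Obj: "f \<in> Arr V \<Longrightarrow> Cod V f \<in> Obj V"
    and Idn_hom: "X \<in> Obj V \<Longrightarrow> Idn V X \<in> homset V X X"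
    and Cmp_hom: "\<lbrakk>f \<in> homset V X Y; g \<in> homset V Y Z\<rbrakk> \<Longrightarrow> g \<cdot> f \<in> homset V X Z"
    and Cmp_Idn: "f \<in> homset V X Y \<Longrightarrow> f \<cdot> Idn V X = f"
    and Idn_Cmp: "f \<in> homset V X Y \<Longrightarrow> Idn V Y \<cdot> f = f"
    and Cmp_assoc: "\<lbrakk>f \<in> homset V X Y; g \<in> homset V Y Z; h \<in> homset V Z W\<rbrakk>
           \<Longrightarrow> h \<cdot> (g \<cdot> f) = (h \<cdot> g) \<cdot> f"

definition iso_arr :: "('o, 'm, 'z) cat_scheme \<Rightarrow> 'm \<Rightarrow> bool"
  where "iso_arr V f \<longleftrightarrow> f \<in> Arr V \<and>
    (\<exists>g \<in> homset V (Cod V f) (Dom V f).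
        g \<cdot>\<^bsub>V\<^esub> f = Idn V (Dom V f) \<and> f \<cdot>\<^bsub>V\<^esub> g = Idn V (Cod V f))"

text \<open>
  A square is always listed as (right vertical \<open>f : X \<rightarrow> Y\<close>, bottom \<open>g : Y' \<rightarrow> Y\<close>,
  left vertical \<open>f' : X' \<rightarrow> Y'\<close>, top \<open>g' : X' \<rightarrow> X\<close>); it pulls \<open>f\<close> back along \<open>g\<close>.
\<close>
definition fibre_square :: "('o, 'm, 'z) cat_scheme \<Rightarrow> 'm \<Rightarrow> 'm \<Rightarrow> 'm \<Rightarrow> 'm \<Rightarrow> bool"
  where "fibre_square V f g f' g' \<longleftrightarrow>
    f \<in> Arr V \<and> g \<in> Arr V \<and> f' \<in> Arr V \<and> g' \<in> Arr V \<and>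
    Cod V f = Cod V g \<and> Dom V f' = Dom V g' \<and> Cod V f' = Dom V g \<and> Cod V g' = Dom V f \<and>
    f \<cdot>\<^bsub>V\<^esub> g' = g \<cdot>\<^bsub>V\<^esub> f' \<and>
    (\<forall>T. \<forall>a \<in> homset V T (Dom V f). \<forall>b \<in> homset V T (Dom V g).
        f \<cdot>\<^bsub>V\<^esub> a = g \<cdot>\<^bsub>V\<^esub> b \<longrightarrow>
        (\<exists>!u. u \<in> homset V T (Dom V f') \<and> g' \<cdot>\<^bsub>V\<^esub> u = a \<and> f' \<cdot>\<^bsub>V\<^esub> u = b))"

text \<open>A chosen fibre product of \<open>f : X \<rightarrow> Y\<close> and \<open>g : Y' \<rightarrow> Y\<close>, as the pair of its
  projections to \<open>Y'\<close> and to \<open>X\<close>, in this order.\<close>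
definition fprod :: "('o, 'm, 'z) cat_scheme \<Rightarrow> 'm \<Rightarrow> 'm \<Rightarrow> 'm \<times> 'm"
  where "fprod V f g = (SOME (f', g'). fibre_square V f g f' g')"

definition is_coproduct :: "('o, 'm, 'z) cat_scheme \<Rightarrow> 'm \<Rightarrow> 'm \<Rightarrow> bool"
  where "is_coproduct V i j \<longleftrightarrow>
    i \<in> Arr V \<and> j \<in> Arr V \<and> Cod V i = Cod V j \<and>
    (\<forall>Z. \<forall>a \<in> homset V (Dom V i) Z. \<forall>b \<in> homset V (Dom V j) Z.
        \<exists>!u. u \<in> homset V (Cod V i) Z \<and> u \<cdot>\<^bsub>V\<^esub> i = a \<and> u \<cdot>\<^bsub>V\<^esub> j = b)"


section \<open>The underlying data\<close>

text \<open>
  The base category itself, a final object, the confined and the specialized morphisms, the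
  independent squares, and a category \<open>tot\<close> over the base with projection \<open>(prO, prA)\<close>.
\<close>
record ('o, 'm, 'l, 'e) bicat = "('o, 'm) cat" +
  pt :: 'o
  Conf :: "'m set"
  Spec :: "'m set"
  indep :: "'m \<Rightarrow> 'm \<Rightarrow> 'm \<Rightarrow> 'm \<Rightarrow> bool"
  tot :: "('l, 'e) cat"
  prO :: "'l \<Rightarrow> 'o"
  prA :: "'e \<Rightarrow> 'm"

definition cartesian :: "('o, 'm, 'l, 'e) bicat \<Rightarrow> 'e \<Rightarrow> bool"
  where "cartesian D e \<longleftrightarrow> e \<in> Arr (tot D) \<and>
    (\<forall>d \<in> Arr (tot D). \<forall>h \<in> homset D (prO D (Dom (tot D) d)) (prO D (Dom (tot D) e)).
        Cod (tot D) d = Cod (tot D) e \<and> prA D d = prA D e \<cdot>\<^bsub>D\<^esub> h \<longrightarrow>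
        (\<exists>!k. k \<in> homset (tot D) (Dom (tot D) d) (Dom (tot D) e) \<and>
              prA D k = h \<and> e \<cdot>\<^bsub>tot D\<^esub> k = d))"

definition fib :: "('o, 'm, 'l, 'e) bicat \<Rightarrow> 'o \<Rightarrow> 'l set"
  where "fib D X = {L \<in> Obj (tot D). prO D L = X}"

text \<open>Isomorphism of fiber-objects in the fibre over a common base object.\<close>
definition fib_iso :: "('o, 'm, 'l, 'e) bicat \<Rightarrow> 'l \<Rightarrow> 'l \<Rightarrow> bool"
  where "fib_iso D L L' \<longleftrightarrow> (\<exists>e \<in> homset (tot D) L L'.
           iso_arr (tot D) e \<and> prO D L = prO D L' \<and> prA D e = Idn D (prO D L))"

text \<open>A chosen pullback \<open>f\<^sup>*L\<close>; it is determined by \<open>f\<close> and \<open>L\<close> up to \<open>fib_iso\<close>.\<close>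
definition fpull :: "('o, 'm, 'l, 'e) bicat \<Rightarrow> 'm \<Rightarrow> 'l \<Rightarrow> 'l"
  where "fpull D f L = (SOME L'. \<exists>e \<in> homset (tot D) L' L. cartesian D e \<and> prA D e = f)"

locale fibered_category =
  fixes D :: "('o, 'm, 'l, 'e) bicat" (structure)
  assumes base_category: "category D"
    and tot_category: "category (tot D)"
    and prO_Obj: "L \<in> Obj (tot D) \<Longrightarrow> prO D L \<in> Obj D"
    and prA_hom: "e \<in> homset (tot D) L M \<Longrightarrow> prA D e \<in> homset D (prO D L) (prO D M)"
    and prA_Idn: "L \<in> Obj (tot D) \<Longrightarrow> prA D (Idn (tot D) L) = Idn D (prO D L)"
    and prA_Cmp: "\<lbrakk>d \<in> homset (tot D) L M; e \<in> homset (tot D) M N\<rbrakk>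
           \<Longrightarrow> prA D (e \<cdot>\<^bsub>tot D\<^esub> d) = prA D e \<cdot> prA D d"
    and cartesian_lift: "\<lbrakk>f \<in> homset D X Y; L \<in> fib D Y\<rbrakk>
           \<Longrightarrow> \<exists>e \<in> Arr (tot D). Cod (tot D) e = L \<and> prA D e = f \<and> cartesian D e"

locale bivariant_data = category D + fibered_category D
  for D :: "('o, 'm, 'l, 'e) bicat" (structure) +
  assumes pt_Obj: "pt D \<in> Obj D"
    and pt_final: "X \<in> Obj D \<Longrightarrow> \<exists>!f. f \<in> homset D X (pt D)"
    and fibre_products: "\<lbrakk>f \<in> homset D X Z; g \<in> homset D Y Z\<rbrakk> \<Longrightarrow> \<exists>f' g'. fibre_square D f g f' g'"
    and Conf_Arr: "Conf D \<subseteq> Arr D"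
    and Conf_Idn: "X \<in> Obj D \<Longrightarrow> Idn D X \<in> Conf D"
    and Conf_Cmp: "\<lbrakk>f \<in> Conf D; g \<in> Conf D; Cod D f = Dom D g\<rbrakk> \<Longrightarrow> g \<cdot> f \<in> Conf D"
    and Conf_base_change: "\<lbrakk>f \<in> Conf D; fibre_square D f g f' g'\<rbrakk> \<Longrightarrow> f' \<in> Conf D"
    and Spec_Arr: "Spec D \<subseteq> Arr D"
    and Spec_Idn: "X \<in> Obj D \<Longrightarrow> Idn D X \<in> Spec D"
    and Spec_Cmp: "\<lbrakk>f \<in> Spec D; g \<in> Spec D; Cod D f = Dom D g\<rbrakk> \<Longrightarrow> g \<cdot> f \<in> Spec D"
    and Spec_base_change: "\<lbrakk>f \<in> Spec D; fibre_square D f g f' g'\<rbrakk> \<Longrightarrow> f' \<in> Spec D"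
    and indep_fibre_square: "indep D f g f' g' \<Longrightarrow> fibre_square D f g f' g'"
    and indep_horizontal: "\<lbrakk>indep D f g f' g'; indep D f' h f'' h'\<rbrakk>
           \<Longrightarrow> indep D f (g \<cdot> h) f'' (g' \<cdot> h')"
    and indep_vertical: "\<lbrakk>indep D g h g' h'; indep D f h' f' h''\<rbrakk>
           \<Longrightarrow> indep D (g \<cdot> f) h (g' \<cdot> f') h''"
    and indep_Idn_horizontal: "f \<in> homset D X Y \<Longrightarrow> indep D f (Idn D Y) f (Idn D X)"
    and indep_Idn_vertical: "f \<in> homset D X Y \<Longrightarrow> indep D (Idn D Y) f (Idn D X) f"

definition trm :: "('o, 'm, 'l, 'e) bicat \<Rightarrow> 'o \<Rightarrow> 'm"
  where "trm D X = (THE f. f \<in> homset D X (pt D))"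

text \<open>\<open>p : P \<rightarrow> X\<close> and \<open>q : P \<rightarrow> Y\<close> are the projections of a product \<open>P = X \<times> Y\<close>. Products are
  not chosen; everything below is required for all of them, so that for instance \<open>Y\<close> with
  its final arrow and its identity is one of the products \<open>pt \<times> Y\<close>.\<close>
definition is_product :: "('o, 'm, 'l, 'e) bicat \<Rightarrow> 'm \<Rightarrow> 'm \<Rightarrow> bool"
  where "is_product D p q \<longleftrightarrow> fibre_square D (trm D (Cod D p)) (trm D (Cod D q)) q p"

definition product_arr ::
    "('o, 'm, 'l, 'e) bicat \<Rightarrow> 'm \<Rightarrow> 'm \<Rightarrow> 'm \<times> 'm \<Rightarrow> 'm \<times> 'm \<Rightarrow> 'm \<Rightarrow> bool"
  where "product_arr D f g = (\<lambda>(p, q) (p', q') u.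
    is_product D p q \<and> is_product D p' q' \<and>
    f \<in> homset D (Cod D p) (Cod D p') \<and> g \<in> homset D (Cod D q) (Cod D q') \<and>
    u \<in> homset D (Dom D p) (Dom D p') \<and>
    p' \<cdot>\<^bsub>D\<^esub> u = f \<cdot>\<^bsub>D\<^esub> p \<and> q' \<cdot>\<^bsub>D\<^esub> u = g \<cdot>\<^bsub>D\<^esub> q)"

text \<open>The squares with \<open>f \<times> id\<close> horizontally and \<open>id \<times> g\<close> vertically are independent,
  in both ways of drawing them.\<close>
definition exterior_squares_independent :: "('o, 'm, 'l, 'e) bicat \<Rightarrow> bool"
  where "exterior_squares_independent D \<longleftrightarrow>
    (\<forall>X X' Y Y'. \<forall>f \<in> homset D X X'. \<forall>g \<in> homset D Y Y'.
      \<forall>XY X'Y XY' X'Y' top bottom left right.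
        product_arr D f (Idn D Y) XY X'Y top \<and>
        product_arr D f (Idn D Y') XY' X'Y' bottom \<and>
        product_arr D (Idn D X) g XY XY' left \<and>
        product_arr D (Idn D X') g X'Y X'Y' right \<longrightarrow>
        indep D right bottom left top \<and> indep D bottom right top left)"

text \<open>The part of the additivity assumptions that concerns the category only. That the
  coproduct inclusions are canonically oriented means that they are specialized.\<close>
definition additive_data :: "('o, 'm, 'l, 'e) bicat \<Rightarrow> bool"
  where "additive_data D \<longleftrightarrow>
    (\<forall>X \<in> Obj D. \<forall>Y \<in> Obj D. \<exists>i j. is_coproduct D i j \<and> Dom D i = X \<and> Dom D j = Y) \<and>
    (\<forall>i j. is_coproduct D i j \<longrightarrow> i \<in> Conf D \<inter> Spec D \<and> j \<in> Conf D \<inter> Spec D) \<and>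
    (\<forall>i j Z. \<forall>f \<in> homset D (Cod D i) Z. is_coproduct D i j \<longrightarrow>
        (f \<in> Conf D \<longleftrightarrow> f \<cdot>\<^bsub>D\<^esub> i \<in> Conf D \<and> f \<cdot>\<^bsub>D\<^esub> j \<in> Conf D)) \<and>
    (\<forall>f g f' g'. fibre_square D f g f' g' \<and> (f \<in> Conf D \<or> g \<in> Conf D) \<longrightarrow> indep D f g f' g')"


section \<open>Bivariant theories\<close>

text \<open>
  The abelian groups are written multiplicatively, as in \<open>HOL-Algebra\<close>. The arrow arguments:
  \<^item> \<open>grp B f\<close> is the group of \<open>f\<close>;
  \<^item> \<open>prd B f g\<close> is the product \<open>B(f) \<times> B(g) \<rightarrow> B(g \<cdot> f)\<close>;
  \<^item> \<open>psh B f g\<close> is the pushforward \<open>f\<^sub>* : B(g \<cdot> f) \<rightarrow> B(g)\<close>;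
  \<^item> \<open>pll B f g f' g'\<close> is the pullback \<open>g\<^sup>* : B(f) \<rightarrow> B(f')\<close> of the square \<open>(f, g, f', g')\<close>.
\<close>
record ('o, 'm, 'b) bivariant =
  grp :: "'m \<Rightarrow> 'b monoid"
  prd :: "'m \<Rightarrow> 'm \<Rightarrow> 'b \<Rightarrow> 'b \<Rightarrow> 'b"
  psh :: "'m \<Rightarrow> 'm \<Rightarrow> 'b \<Rightarrow> 'b"
  pll :: "'m \<Rightarrow> 'm \<Rightarrow> 'm \<Rightarrow> 'm \<Rightarrow> 'b \<Rightarrow> 'b"
  unt :: "'o \<Rightarrow> 'b"

locale bivariant_theory = bivariant_data D
  for D :: "('o, 'm, 'l, 'e) bicat" (structure) +
  fixes B :: "('o, 'm, 'b, 'z) bivariant_scheme"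
  assumes grp_comm_group: "f \<in> Arr D \<Longrightarrow> comm_group (grp B f)"
    and prd_hom_left: "\<lbrakk>f \<in> homset D X Y; g \<in> homset D Y Z; \<beta> \<in> carrier (grp B g)\<rbrakk>
           \<Longrightarrow> (\<lambda>\<alpha>. prd B f g \<alpha> \<beta>) \<in> hom (grp B f) (grp B (g \<cdot> f))"
    and prd_hom_right: "\<lbrakk>f \<in> homset D X Y; g \<in> homset D Y Z; \<alpha> \<in> carrier (grp B f)\<rbrakk>
           \<Longrightarrow> prd B f g \<alpha> \<in> hom (grp B g) (grp B (g \<cdot> f))"
    and psh_hom: "\<lbrakk>f \<in> homset D X Y; g \<in> homset D Y Z; f \<in> Conf D\<rbrakk>
           \<Longrightarrow> psh B f g \<in> hom (grp B (g \<cdot> f)) (grp B g)"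
    and pll_hom: "indep D f g f' g' \<Longrightarrow> pll B f g f' g' \<in> hom (grp B f) (grp B f')"
    and unt_closed: "X \<in> Obj D \<Longrightarrow> unt B X \<in> carrier (grp B (Idn D X))"
    and prd_assoc:
      "\<lbrakk>f \<in> homset D X Y; g \<in> homset D Y Z; h \<in> homset D Z W;
        \<alpha> \<in> carrier (grp B f); \<beta> \<in> carrier (grp B g); \<gamma> \<in> carrier (grp B h)\<rbrakk>
       \<Longrightarrow> prd B (g \<cdot> f) h (prd B f g \<alpha> \<beta>) \<gamma> = prd B f (h \<cdot> g) \<alpha> (prd B g h \<beta> \<gamma>)"
    and psh_Idn: "\<lbrakk>f \<in> homset D X Y; \<alpha> \<in> carrier (grp B f)\<rbrakk> \<Longrightarrow> psh B (Idn D X) f \<alpha> = \<alpha>"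
    and psh_Cmp:
      "\<lbrakk>f \<in> homset D X Y; g \<in> homset D Y Z; h \<in> homset D Z W; f \<in> Conf D; g \<in> Conf D;
        \<alpha> \<in> carrier (grp B (h \<cdot> (g \<cdot> f)))\<rbrakk>
       \<Longrightarrow> psh B (g \<cdot> f) h \<alpha> = psh B g h (psh B f (h \<cdot> g) \<alpha>)"
    and pll_Idn:
      "\<lbrakk>f \<in> homset D X Y; \<alpha> \<in> carrier (grp B f)\<rbrakk> \<Longrightarrow> pll B f (Idn D Y) f (Idn D X) \<alpha> = \<alpha>"
    and pll_Cmp:
      "\<lbrakk>indep D f g f' g'; indep D f' h f'' h'; \<alpha> \<in> carrier (grp B f)\<rbrakk>
       \<Longrightarrow> pll B f (g \<cdot> h) f'' (g' \<cdot> h') \<alpha> = pll B f' h f'' h' (pll B f g f' g' \<alpha>)"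
    and psh_prd:
      "\<lbrakk>f \<in> homset D X Y; g \<in> homset D Y Z; h \<in> homset D Z W; f \<in> Conf D;
        \<alpha> \<in> carrier (grp B (g \<cdot> f)); \<beta> \<in> carrier (grp B h)\<rbrakk>
       \<Longrightarrow> psh B f (h \<cdot> g) (prd B (g \<cdot> f) h \<alpha> \<beta>) = prd B g h (psh B f g \<alpha>) \<beta>"
    and pll_prd:
      "\<lbrakk>indep D g h g' h'; indep D f h' f' h'';
        \<alpha> \<in> carrier (grp B f); \<beta> \<in> carrier (grp B g)\<rbrakk>
       \<Longrightarrow> pll B (g \<cdot> f) h (g' \<cdot> f') h'' (prd B f g \<alpha> \<beta>)
           = prd B f' g' (pll B f h' f' h'' \<alpha>) (pll B g h g' h' \<beta>)"
    and psh_pll: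
      "\<lbrakk>indep D g h g' h'; indep D f h' f' h''; f \<in> Conf D; \<alpha> \<in> carrier (grp B (g \<cdot> f))\<rbrakk>
       \<Longrightarrow> psh B f' g' (pll B (g \<cdot> f) h (g' \<cdot> f') h'' \<alpha>) = pll B g h g' h' (psh B f g \<alpha>)"
    and projection_formula:
      "\<lbrakk>indep D f g f' g'; g \<in> Conf D; h \<in> homset D (Cod D f) Z;
        \<alpha> \<in> carrier (grp B f); \<beta> \<in> carrier (grp B (h \<cdot> g))\<rbrakk>
       \<Longrightarrow> psh B g' (h \<cdot> f) (prd B f' (h \<cdot> g) (pll B f g f' g' \<alpha>) \<beta>)
           = prd B f h \<alpha> (psh B g h \<beta>)"
    and prd_unt: "\<lbrakk>f \<in> homset D W X; \<alpha> \<in> carrier (grp B f)\<rbrakk>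
           \<Longrightarrow> prd B f (Idn D X) \<alpha> (unt B X) = \<alpha>"
    and unt_prd: "\<lbrakk>f \<in> homset D X Y; \<beta> \<in> carrier (grp B f)\<rbrakk>
           \<Longrightarrow> prd B (Idn D X) f (unt B X) \<beta> = \<beta>"
    and pll_unt: "g \<in> homset D X' X \<Longrightarrow> pll B (Idn D X) g (Idn D X') g (unt B X) = unt B X'"
    and commutative:
      "\<lbrakk>indep D f g f' g'; indep D g f g' f'; \<alpha> \<in> carrier (grp B f); \<beta> \<in> carrier (grp B g)\<rbrakk>
       \<Longrightarrow> prd B f' g (pll B f g f' g' \<alpha>) \<beta> = prd B g' f (pll B g f g' f' \<beta>) \<alpha>"

record ('o, 'm, 'l, 'b) oriented_bivariant = "('o, 'm, 'b) bivariant" +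
  ori :: "'m \<Rightarrow> 'l \<Rightarrow> 'b \<Rightarrow> 'b"

text \<open>\<open>ori B f L\<close> is the operator \<open>\<phi>(L)\<close> on \<open>B(f : X \<rightarrow> Y)\<close>, for \<open>L\<close> over \<open>X\<close>.\<close>
locale oriented_bivariant_theory = bivariant_theory D B
  for D :: "('o, 'm, 'l, 'e) bicat" (structure)
    and B :: "('o, 'm, 'l, 'b) oriented_bivariant" +
  assumes ori_hom: "\<lbrakk>f \<in> homset D X Y; L \<in> fib D X\<rbrakk> \<Longrightarrow> ori B f L \<in> hom (grp B f) (grp B f)"
    and ori_iso:
      "\<lbrakk>f \<in> homset D X Y; L \<in> fib D X; L' \<in> fib D X; fib_iso D L L'; \<alpha> \<in> carrier (grp B f)\<rbrakk>
       \<Longrightarrow> ori B f L \<alpha> = ori B f L' \<alpha>"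
    and ori_commute:
      "\<lbrakk>f \<in> homset D X Y; L \<in> fib D X; L' \<in> fib D X; \<alpha> \<in> carrier (grp B f)\<rbrakk>
       \<Longrightarrow> ori B f L (ori B f L' \<alpha>) = ori B f L' (ori B f L \<alpha>)"
    and ori_prd_left:
      "\<lbrakk>f \<in> homset D X Y; g \<in> homset D Y Z; L \<in> fib D X;
        \<alpha> \<in> carrier (grp B f); \<beta> \<in> carrier (grp B g)\<rbrakk>
       \<Longrightarrow> ori B (g \<cdot> f) L (prd B f g \<alpha> \<beta>) = prd B f g (ori B f L \<alpha>) \<beta>"
    and ori_prd_right:
      "\<lbrakk>f \<in> homset D X Y; g \<in> homset D Y Z; M \<in> fib D Y;
        \<alpha> \<in> carrier (grp B f); \<beta> \<in> carrier (grp B g)\<rbrakk>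
       \<Longrightarrow> ori B (g \<cdot> f) (fpull D f M) (prd B f g \<alpha> \<beta>) = prd B f g \<alpha> (ori B g M \<beta>)"
    and ori_psh:
      "\<lbrakk>f \<in> homset D X Y; g \<in> homset D Y Z; f \<in> Conf D; M \<in> fib D Y;
        \<alpha> \<in> carrier (grp B (g \<cdot> f))\<rbrakk>
       \<Longrightarrow> psh B f g (ori B (g \<cdot> f) (fpull D f M) \<alpha>) = ori B g M (psh B f g \<alpha>)"
    and ori_pll:
      "\<lbrakk>indep D f g f' g'; L \<in> fib D (Dom D f); \<alpha> \<in> carrier (grp B f)\<rbrakk>
       \<Longrightarrow> pll B f g f' g' (ori B f L \<alpha>) = ori B f' (fpull D g' L) (pll B f g f' g' \<alpha>)"

text \<open>\<open>\<theta>\<close> is a nice canonical orientation of the class of specialized morphisms.\<close>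
definition nice_canonical_orientation ::
    "('o, 'm, 'l, 'e) bicat \<Rightarrow> ('o, 'm, 'b, 'z) bivariant_scheme \<Rightarrow> ('m \<Rightarrow> 'b) \<Rightarrow> bool"
  where "nice_canonical_orientation D B \<theta> \<longleftrightarrow>
    (\<forall>f \<in> Spec D. \<theta> f \<in> carrier (grp B f)) \<and>
    (\<forall>f \<in> Spec D. \<forall>g \<in> Spec D. Cod D f = Dom D g \<longrightarrow>
        \<theta> (g \<cdot>\<^bsub>D\<^esub> f) = prd B f g (\<theta> f) (\<theta> g)) \<and>
    (\<forall>X \<in> Obj D. \<theta> (Idn D X) = unt B X) \<and>
    (\<forall>f g f' g'. f \<in> Spec D \<and> indep D f g f' g' \<longrightarrow> \<theta> f' = pll B f g f' g' (\<theta> f))"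

definition strongly_oriented ::
    "('o, 'm, 'l, 'e) bicat \<Rightarrow> ('o, 'm, 'b, 'z) bivariant_scheme \<Rightarrow> ('m \<Rightarrow> 'b) \<Rightarrow> 'm \<Rightarrow> bool"
  where "strongly_oriented D B \<theta> i \<longleftrightarrow>
    (\<forall>W. \<forall>g \<in> homset D W (Dom D i).
        (\<lambda>\<alpha>. prd B g i \<alpha> (\<theta> i)) \<in> iso (grp B g) (grp B (i \<cdot>\<^bsub>D\<^esub> g)))"

definition additive_theory ::
    "('o, 'm, 'l, 'e) bicat \<Rightarrow> ('o, 'm, 'b, 'z) bivariant_scheme \<Rightarrow> ('m \<Rightarrow> 'b) \<Rightarrow> bool"
  where "additive_theory D B \<theta> \<longleftrightarrow>
    (\<forall>i j. is_coproduct D i j \<longrightarrow> strongly_oriented D B \<theta> i \<and> strongly_oriented D B \<theta> j) \<and>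
    (\<forall>i j Z. \<forall>f \<in> homset D (Cod D i) Z. is_coproduct D i j \<longrightarrow>
        (\<lambda>(\<alpha>, \<beta>). psh B i f \<alpha> \<otimes>\<^bsub>grp B f\<^esub> psh B j f \<beta>)
          \<in> iso (grp B (f \<cdot>\<^bsub>D\<^esub> i) \<times>\<times> grp B (f \<cdot>\<^bsub>D\<^esub> j)) (grp B f))"


section \<open>The associated covariant and contravariant functors\<close>

definition bm_grp where "bm_grp D B X = grp B (trm D X)"

definition bm_push where "bm_push D B f \<alpha> = psh B f (trm D (Cod D f)) \<alpha>"

definition bm_gysin where "bm_gysin D B \<theta> f \<alpha> = prd B f (trm D (Cod D f)) (\<theta> f) \<alpha>"

text \<open>Exterior products depend on the projections \<open>p : P \<rightarrow> X\<close>, \<open>q : P \<rightarrow> Y\<close> of a product of \<open>X\<close> and \<open>Y\<close>.\<close>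
definition bm_ext where
  "bm_ext D B p q \<alpha> \<beta> =
     prd B q (trm D (Cod D q)) (pll B (trm D (Cod D p)) (trm D (Cod D q)) q p \<alpha>) \<beta>"

definition co_grp where "co_grp D B X = grp B (Idn D X)"

definition co_pull where
  "co_pull D B f \<alpha> = pll B (Idn D (Cod D f)) f (Idn D (Dom D f)) f \<alpha>"

definition co_gysin where
  "co_gysin D B \<theta> f \<alpha> = psh B f (Idn D (Cod D f)) (prd B (Idn D (Dom D f)) f \<alpha> (\<theta> f))"

definition co_ext where
  "co_ext D B p q \<alpha> \<beta> =
     prd B (Idn D (Dom D p)) (Idn D (Dom D p)) (co_pull D B p \<alpha>) (co_pull D B q \<beta>)"

definition bm_nat_trans ::
    "('o, 'm, 'l, 'e) bicat \<Rightarrow> ('o, 'm, 'l, 'a) oriented_bivariant \<Rightarrow> ('m \<Rightarrow> 'a) \<Rightarrow>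
     ('o, 'm, 'l, 'b) oriented_bivariant \<Rightarrow> ('m \<Rightarrow> 'b) \<Rightarrow> ('o \<Rightarrow> 'a \<Rightarrow> 'b) \<Rightarrow> bool"
  where "bm_nat_trans D A \<eta> B \<theta> \<gamma> \<longleftrightarrow>
    (\<forall>X \<in> Obj D. \<gamma> X \<in> hom (bm_grp D A X) (bm_grp D B X)) \<and>
    (\<forall>f \<in> Conf D. \<forall>\<alpha> \<in> carrier (bm_grp D A (Dom D f)).
        \<gamma> (Cod D f) (bm_push D A f \<alpha>) = bm_push D B f (\<gamma> (Dom D f) \<alpha>)) \<and>
    (\<forall>f \<in> Spec D. \<forall>\<alpha> \<in> carrier (bm_grp D A (Cod D f)).
        \<gamma> (Dom D f) (bm_gysin D A \<eta> f \<alpha>) = bm_gysin D B \<theta> f (\<gamma> (Cod D f) \<alpha>)) \<and>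
    (\<forall>p q. is_product D p q \<longrightarrow>
        (\<forall>\<alpha> \<in> carrier (bm_grp D A (Cod D p)). \<forall>\<beta> \<in> carrier (bm_grp D A (Cod D q)).
          \<gamma> (Dom D p) (bm_ext D A p q \<alpha> \<beta>)
            = bm_ext D B p q (\<gamma> (Cod D p) \<alpha>) (\<gamma> (Cod D q) \<beta>))) \<and>
    (\<forall>X \<in> Obj D. \<forall>L \<in> fib D X. \<forall>\<alpha> \<in> carrier (bm_grp D A X).
        \<gamma> X (ori A (trm D X) L \<alpha>) = ori B (trm D X) L (\<gamma> X \<alpha>))"

definition co_nat_trans ::
    "('o, 'm, 'l, 'e) bicat \<Rightarrow> ('o, 'm, 'l, 'a) oriented_bivariant \<Rightarrow> ('m \<Rightarrow> 'a) \<Rightarrow>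
     ('o, 'm, 'l, 'b) oriented_bivariant \<Rightarrow> ('m \<Rightarrow> 'b) \<Rightarrow> ('o \<Rightarrow> 'a \<Rightarrow> 'b) \<Rightarrow> bool"
  where "co_nat_trans D A \<eta> B \<theta> \<gamma> \<longleftrightarrow>
    (\<forall>X \<in> Obj D. \<gamma> X \<in> hom (co_grp D A X) (co_grp D B X)) \<and>
    (\<forall>f \<in> Arr D. \<forall>\<alpha> \<in> carrier (co_grp D A (Cod D f)).
        \<gamma> (Dom D f) (co_pull D A f \<alpha>) = co_pull D B f (\<gamma> (Cod D f) \<alpha>)) \<and>
    (\<forall>f \<in> Conf D \<inter> Spec D. \<forall>\<alpha> \<in> carrier (co_grp D A (Dom D f)).
        \<gamma> (Cod D f) (co_gysin D A \<eta> f \<alpha>) = co_gysin D B \<theta> f (\<gamma> (Dom D f) \<alpha>)) \<and>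
    (\<forall>p q. is_product D p q \<longrightarrow>
        (\<forall>\<alpha> \<in> carrier (co_grp D A (Cod D p)). \<forall>\<beta> \<in> carrier (co_grp D A (Cod D q)).
          \<gamma> (Dom D p) (co_ext D A p q \<alpha> \<beta>)
            = co_ext D B p q (\<gamma> (Cod D p) \<alpha>) (\<gamma> (Cod D q) \<beta>))) \<and>
    (\<forall>X \<in> Obj D. \<forall>L \<in> fib D X. \<forall>\<alpha> \<in> carrier (co_grp D A X).
        \<gamma> X (ori A (Idn D X) L \<alpha>) = ori B (Idn D X) L (\<gamma> X \<alpha>))"


section \<open>Cobordism cycles and the theory OM\<close>

text \<open>The cycle \<open>(V \<rightarrow> X; L\<^sub>1, \<dots>, L\<^sub>r)\<close> is the pair of the arrow and the list of fiber-objects.\<close>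
type_synonym ('m, 'l) cycle = "'m \<times> 'l list"

definition cycles :: "('o, 'm, 'l, 'e) bicat \<Rightarrow> 'o \<Rightarrow> ('m, 'l) cycle set"
  where "cycles D X = {(h, Ls). h \<in> Arr D \<and> Cod D h = X \<and> set Ls \<subseteq> fib D (Dom D h)}"

definition cycle_iso :: "('o, 'm, 'l, 'e) bicat \<Rightarrow> ('m, 'l) cycle \<Rightarrow> ('m, 'l) cycle \<Rightarrow> bool"
  where "cycle_iso D = (\<lambda>(h, Ls) (k, Ms). length Ls = length Ms \<and>
    (\<exists>g \<sigma>. g \<in> homset D (Dom D h) (Dom D k) \<and> iso_arr D g \<and> k \<cdot>\<^bsub>D\<^esub> g = h \<and>
       \<sigma> permutes {..<length Ls} \<and>
       (\<forall>i < length Ls. fib_iso D (Ls ! i) (fpull D g (Ms ! \<sigma> i)))))"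

text \<open>The isomorphism class of a cycle.\<close>
definition cyc :: "('o, 'm, 'l, 'e) bicat \<Rightarrow> 'm \<Rightarrow> 'l list \<Rightarrow> ('m, 'l) cycle set"
  where "cyc D h Ls = {z \<in> cycles D (Cod D h). cycle_iso D (h, Ls) z}"

definition om_generators :: "('o, 'm, 'l, 'e) bicat \<Rightarrow> 'm \<Rightarrow> ('m, 'l) cycle set set"
  where "om_generators D f = {cyc D h Ls | h Ls.
    (h, Ls) \<in> cycles D (Dom D f) \<and> h \<in> Conf D \<and> f \<cdot>\<^bsub>D\<^esub> h \<in> Spec D}"

text \<open>The operations are given on cycles; they are evaluated on a representative of each
  isomorphism class and extended linearly.\<close>
definition rep :: "('m, 'l) cycle set \<Rightarrow> ('m, 'l) cycle"
  where "rep c = (SOME z. z \<in> c)"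

definition om_push :: "('o, 'm, 'l, 'e) bicat \<Rightarrow> 'm \<Rightarrow> 'm \<Rightarrow>
    (('m, 'l) cycle set \<Rightarrow>\<^sub>0 int) \<Rightarrow> (('m, 'l) cycle set \<Rightarrow>\<^sub>0 int)"
  where "om_push D f g =
    frag_extend (\<lambda>c. case rep c of (h, Ls) \<Rightarrow> frag_of (cyc D (f \<cdot>\<^bsub>D\<^esub> h) Ls))"

definition om_pull :: "('o, 'm, 'l, 'e) bicat \<Rightarrow> 'm \<Rightarrow> 'm \<Rightarrow> 'm \<Rightarrow> 'm \<Rightarrow>
    (('m, 'l) cycle set \<Rightarrow>\<^sub>0 int) \<Rightarrow> (('m, 'l) cycle set \<Rightarrow>\<^sub>0 int)"
  where "om_pull D f g f' g' =
    frag_extend (\<lambda>c. case rep c of (h, Ls) \<Rightarrow>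
      (case fprod D h g' of (h', g'') \<Rightarrow> frag_of (cyc D h' (map (fpull D g'') Ls))))"

definition om_prod :: "('o, 'm, 'l, 'e) bicat \<Rightarrow> 'm \<Rightarrow> 'm \<Rightarrow>
    (('m, 'l) cycle set \<Rightarrow>\<^sub>0 int) \<Rightarrow> (('m, 'l) cycle set \<Rightarrow>\<^sub>0 int) \<Rightarrow> (('m, 'l) cycle set \<Rightarrow>\<^sub>0 int)"
  where "om_prod D f g \<alpha> \<beta> =
    frag_extend (\<lambda>a. frag_extend (\<lambda>b.
      case rep a of (h, Ls) \<Rightarrow> case rep b of (k, Ms) \<Rightarrow>
      case fprod D f k of (f', k') \<Rightarrow> case fprod D h k' of (h', k'') \<Rightarrow>
        frag_of (cyc D (h \<cdot>\<^bsub>D\<^esub> k'') (map (fpull D k'') Ls @ map (fpull D (f' \<cdot>\<^bsub>D\<^esub> h')) Ms)))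
      \<beta>) \<alpha>"

definition om_ori :: "('o, 'm, 'l, 'e) bicat \<Rightarrow> 'm \<Rightarrow> 'l \<Rightarrow>
    (('m, 'l) cycle set \<Rightarrow>\<^sub>0 int) \<Rightarrow> (('m, 'l) cycle set \<Rightarrow>\<^sub>0 int)"
  where "om_ori D f L =
    frag_extend (\<lambda>c. case rep c of (h, Ls) \<Rightarrow> frag_of (cyc D h (Ls @ [fpull D h L])))"

definition OM :: "('o, 'm, 'l, 'e) bicat \<Rightarrow>
    ('o, 'm, 'l, ('m, 'l) cycle set \<Rightarrow>\<^sub>0 int) oriented_bivariant"
  where "OM D =
    \<lparr>grp = (\<lambda>f. free_Abelian_group (om_generators D f)),
     prd = om_prod D, psh = om_push D, pll = om_pull D,
     unt = (\<lambda>X. frag_of (cyc D (Idn D X) [])),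
     ori = om_ori D\<rparr>"

definition om_theta :: "('o, 'm, 'l, 'e) bicat \<Rightarrow> 'm \<Rightarrow> (('m, 'l) cycle set \<Rightarrow>\<^sub>0 int)"
  where "om_theta D f = frag_of (cyc D (Idn D (Dom D f)) [])"

end

theory Submission
  imports Defs
begin

text \<open>
The transformation is written down for every arrow at once. A cycle \<open>(h : V \<rightarrow> X; L\<^sub>1, \<dots>, L\<^sub>r)\<close> over
\<open>f : X \<rightarrow> Y\<close> has \<open>f \<cdot> h\<close> specialized, so an oriented theory \<open>B\<close> contains \<open>\<theta>(f \<cdot> h)\<close> in \<open>B(f \<cdot> h)\<close>,
the operators \<open>\<phi>(L\<^sub>i)\<close> act on it, and as \<open>h\<close> is confined the result can be pushed forward to
\<open>B(f)\<close>:
  \<open>\<gamma>[h; L\<^sub>1, \<dots>, L\<^sub>r] = h\<^sub>*(\<phi>(L\<^sub>1) \<dots> \<phi>(L\<^sub>r) \<theta>(f \<cdot> h))\<close>.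
This is \<open>cycle_value\<close>, and its additive extension is \<open>om_value\<close>. The two transformations of the
theorem are \<open>\<gamma>\<close> for the arrows \<open>X \<rightarrow> pt\<close> and for the identities.

The value depends only on the isomorphism class of the cycle (\<open>cycle_value_iso\<close>). The point
is that \<open>u\<^sub>*\<theta>(w \<cdot> u) = \<theta>(w)\<close> for an isomorphism \<open>u\<close> (\<open>psh_theta_iso\<close>): the square formed by
\<open>u\<close>, \<open>u\<close> and two identities is a fibre square, and the projection formula for it says that
\<open>\<theta>(u) \<bullet> _\<close> is inverse to \<open>u\<^sub>*\<close>. The operators then match because they are insensitive to
isomorphism of fiber-objects and commute with each other.

That \<open>\<gamma>\<close> respects pushforward, pullback, product and orientation is checked on cycles
(\<open>cycle_value_psh\<close>, \<open>cycle_value_pll\<close>, \<open>cycle_value_prd\<close>, \<open>cycle_value_ori\<close>). The fibre squares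
chosen in the operations on cycles have the confined arrow of a cycle on one side, hence are
independent, and the axioms of \<open>B\<close> apply to them; for the product the decisive one is the
projection formula. Gysin maps and exterior products are composed of these operations,
and the canonical orientation of \<open>OM\<close> goes to \<open>\<theta>\<close>, so both families are natural
transformations of the required kind. For exterior products on the covariant side the square
of \<open>X \<times> Y\<close> over the point has to be independent; it is one of the exterior squares
(\<open>product_square_indep\<close>).

Uniqueness holds because the normalized elements generate: \<open>[h; L\<^sub>1, \<dots>, L\<^sub>r]\<close> is \<open>h\<^sub>*\<close>, or in the
contravariant case \<open>h\<^sub>!\<close>, of \<open>[id\<^sub>V; L\<^sub>1, \<dots>, L\<^sub>r]\<close> (\<open>om_push_Idn\<close>, \<open>om_prod_theta_Idn\<close>). The operations of
\<open>OM\<close> choose representatives of isomorphism classes and fibre products, so this takes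
that isomorphism of cycles is an equivalence relation, which rests on the functoriality of the
pullback of fiber-objects up to isomorphism.
\<close>


section \<open>Arrows and fibre squares\<close>

context category
begin

lemma homsetD:
  assumes "f \<in> homset V X Y"
  shows "f \<in> Arr V" "Dom V f = X" "Cod V f = Y" "X \<in> Obj V" "Y \<in> Obj V"
  using assms Dom_Obj Cod_Obj by (auto simp: homset_def)

lemma Cmp_simps:
  assumes "f \<in> Arr V" "g \<in> Arr V" "Cod V f = Dom V g"
  shows "g \<cdot> f \<in> Arr V" "Dom V (g \<cdot> f) = Dom V f" "Cod V (g \<cdot> f) = Cod V g"
  using Cmp_hom[of f "Dom V f" "Dom V g" g "Cod V g"] assms by (auto simp: homset_def)

lemma Idn_simps:
  assumes "X \<in> Obj V"
  shows "Idn V X \<in> Arr V" "Dom V (Idn V X) = X" "Cod V (Idn V X) = X"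
  using Idn_hom[OF assms] by (auto simp: homset_def)

lemma Cmp_Idn_Arr: "f \<in> Arr V \<Longrightarrow> Dom V f = X \<Longrightarrow> f \<cdot> Idn V X = f"
  using Cmp_Idn by (auto simp: homset_def)

lemma Idn_Cmp_Arr: "f \<in> Arr V \<Longrightarrow> Cod V f = Y \<Longrightarrow> Idn V Y \<cdot> f = f"
  using Idn_Cmp by (auto simp: homset_def)

lemma Cmp_assoc_Arr:
  "f \<in> Arr V \<Longrightarrow> g \<in> Arr V \<Longrightarrow> h \<in> Arr V \<Longrightarrow> Cod V f = Dom V g \<Longrightarrow> Cod V g = Dom V h
    \<Longrightarrow> (h \<cdot> g) \<cdot> f = h \<cdot> (g \<cdot> f)"
  using Cmp_assoc[of f "Dom V f" "Dom V g" g "Dom V h" h "Cod V h"] by (auto simp: homset_def)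

lemmas arr_simps = Cmp_simps Idn_simps Cmp_Idn_Arr Idn_Cmp_Arr Dom_Obj Cod_Obj

lemma iso_arrE:
  assumes "iso_arr V u" "u \<in> homset V X Y"
  obtains v where "v \<in> homset V Y X" "v \<cdot> u = Idn V X" "u \<cdot> v = Idn V Y" "iso_arr V v"
proof -
  obtain v where v: "v \<in> homset V Y X" "v \<cdot> u = Idn V X" "u \<cdot> v = Idn V Y"
    using assms by (auto simp: iso_arr_def homset_def)
  moreover have "iso_arr V v"
    unfolding iso_arr_def using v assms(2) by (auto simp: homset_def)
  ultimately show thesis using that by blast
qed

lemma iso_arrI:
  "u \<in> homset V X Y \<Longrightarrow> v \<in> homset V Y X \<Longrightarrow> v \<cdot> u = Idn V X \<Longrightarrow> u \<cdot> v = Idn V Y \<Longrightarrow> iso_arr V u"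
  by (auto simp: iso_arr_def homset_def)

lemma iso_arr_Idn: "X \<in> Obj V \<Longrightarrow> iso_arr V (Idn V X)"
  by (rule iso_arrI[of _ X X "Idn V X"]) (auto simp: Idn_hom arr_simps)

lemma iso_arr_Cmp:
  assumes u: "iso_arr V u" "u \<in> homset V X Y" and w: "iso_arr V w" "w \<in> homset V Y Z"
  shows "iso_arr V (w \<cdot> u)"
proof -
  obtain u' where u': "u' \<in> homset V Y X" "u' \<cdot> u = Idn V X" "u \<cdot> u' = Idn V Y"
    using u by (rule iso_arrE)
  obtain w' where w': "w' \<in> homset V Z Y" "w' \<cdot> w = Idn V Y" "w \<cdot> w' = Idn V Z"
    using w by (rule iso_arrE)
  have "u' \<cdot> w' \<cdot> (w \<cdot> u) = u' \<cdot> (w' \<cdot> w \<cdot> u)"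
    using u(2) w(2) u'(1) w'(1) by (simp add: homset_def arr_simps Cmp_assoc_Arr)
  moreover have "w \<cdot> u \<cdot> (u' \<cdot> w') = w \<cdot> (u \<cdot> u' \<cdot> w')"
    using u(2) w(2) u'(1) w'(1) by (simp add: homset_def arr_simps Cmp_assoc_Arr)
  ultimately show ?thesis
    using u(2) w(2) u' w'
    by (intro iso_arrI[of _ X Z "u' \<cdot> w'"]) (auto simp: homset_def arr_simps)
qed

lemma fibre_squareD:
  assumes "fibre_square V f g f' g'"
  shows "f \<in> Arr V" "g \<in> Arr V" "f' \<in> Arr V" "g' \<in> Arr V"
    "Cod V f = Cod V g" "Dom V f' = Dom V g'" "Cod V f' = Dom V g" "Cod V g' = Dom V f"
    "f \<cdot> g' = g \<cdot> f'"
  using assms by (auto simp: fibre_square_def)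

lemma fibre_square_sym: "fibre_square V f g f' g' \<Longrightarrow> fibre_square V g f g' f'"
  unfolding fibre_square_def by (auto simp: conj_commute) metis+

lemma fibre_square_lift:
  assumes "fibre_square V f g f' g'" "a \<in> homset V T (Dom V f)" "b \<in> homset V T (Dom V g)"
    "f \<cdot> a = g \<cdot> b"
  obtains u where "u \<in> homset V T (Dom V f')" "g' \<cdot> u = a" "f' \<cdot> u = b"
  using assms unfolding fibre_square_def by blast

lemma fibre_square_eq:
  assumes "fibre_square V f g f' g'" "u \<in> homset V T (Dom V f')" "w \<in> homset V T (Dom V f')"
    "g' \<cdot> u = g' \<cdot> w" "f' \<cdot> u = f' \<cdot> w"
  shows "u = w"
proof -
  note sq = fibre_squareD[OF assms(1)]
  have "g' \<cdot> u \<in> homset V T (Dom V f)" "f' \<cdot> u \<in> homset V T (Dom V g)"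
    using sq assms(2) by (auto simp: homset_def arr_simps)
  moreover have "f \<cdot> (g' \<cdot> u) = g \<cdot> (f' \<cdot> u)"
    using sq assms(2) Cmp_assoc_Arr[of u g' f] Cmp_assoc_Arr[of u f' g] by (simp add: homset_def)
  ultimately have "\<exists>!x. x \<in> homset V T (Dom V f') \<and> g' \<cdot> x = g' \<cdot> u \<and> f' \<cdot> x = f' \<cdot> u"
    using assms(1) unfolding fibre_square_def by blast
  then show ?thesis using assms by (metis (no_types, lifting))
qed

text \<open>
  The inverse of \<open>f'\<close> is the arrow into the fibre product with components \<open>f\<^sup>-\<^sup>1 \<cdot> g\<close> and \<open>id\<close>.
\<close>
lemma iso_arr_base_change:
  assumes sq: "fibre_square V f g f' g'" and "iso_arr V f"
  shows "iso_arr V f'"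
proof -
  note sqD = fibre_squareD[OF sq]
  obtain v where v: "v \<in> homset V (Cod V f) (Dom V f)"
      "v \<cdot> f = Idn V (Dom V f)" "f \<cdot> v = Idn V (Cod V f)"
    using assms(2) sqD(1) by (auto simp: iso_arr_def)
  note vD = homsetD[OF v(1)]
  have "f \<cdot> (v \<cdot> g) = g \<cdot> Idn V (Dom V g)"
    using sqD vD v by (simp add: arr_simps flip: Cmp_assoc_Arr)
  then obtain w where w: "w \<in> homset V (Dom V g) (Dom V f')" "g' \<cdot> w = v \<cdot> g"
      "f' \<cdot> w = Idn V (Dom V g)"
    using fibre_square_lift[OF sq, of "v \<cdot> g" "Dom V g" "Idn V (Dom V g)"] sqD vD
    by (auto simp: homset_def arr_simps)
  note wD = homsetD[OF w(1)]
  have "g' \<cdot> (w \<cdot> f') = v \<cdot> g \<cdot> f'"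
    using sqD wD w(2) by (simp flip: Cmp_assoc_Arr)
  also have "\<dots> = v \<cdot> (f \<cdot> g')"
    using sqD vD by (simp add: Cmp_assoc_Arr)
  also have "\<dots> = v \<cdot> f \<cdot> g'"
    using sqD(1,4,8) vD by (simp add: Cmp_assoc_Arr)
  finally have 1: "g' \<cdot> (w \<cdot> f') = g' \<cdot> Idn V (Dom V f')"
    using sqD v(2) by (simp add: arr_simps)
  have 2: "f' \<cdot> (w \<cdot> f') = f' \<cdot> Idn V (Dom V f')"
    using sqD wD w by (simp add: arr_simps flip: Cmp_assoc_Arr)
  have "w \<cdot> f' = Idn V (Dom V f')"
    using sqD wD by (intro fibre_square_eq[OF sq _ _ 1 2]) (auto simp: homset_def arr_simps)
  then show ?thesis
    using w sqD by (intro iso_arrI[of _ "Dom V f'" "Dom V g" w]) (auto simp: homset_def)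
qed

text \<open>
  Exhibits an isomorphism as a base change of an identity, so that every class of arrows which
  contains the identities and is stable under base change contains the isomorphisms.
\<close>
lemma fibre_square_Idn_iso:
  assumes "u \<in> homset V X Y" "iso_arr V u"
  shows "fibre_square V (Idn V Y) (Idn V Y) u u"
proof -
  note uD = homsetD[OF assms(1)]
  obtain v where v: "v \<in> homset V Y X" "v \<cdot> u = Idn V X" "u \<cdot> v = Idn V Y"
    using assms(2,1) by (rule iso_arrE)
  note vD = homsetD[OF v(1)]
  have "\<exists>!w. w \<in> homset V T X \<and> u \<cdot> w = a \<and> u \<cdot> w = a" if a: "a \<in> homset V T Y" for T a
  proof (rule ex1I[of _ "v \<cdot> a"])
    show "v \<cdot> a \<in> homset V T X \<and> u \<cdot> (v \<cdot> a) = a \<and> u \<cdot> (v \<cdot> a) = a"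
      using uD vD v homsetD[OF a] by (auto simp: homset_def arr_simps simp flip: Cmp_assoc_Arr)
    fix w assume w: "w \<in> homset V T X \<and> u \<cdot> w = a \<and> u \<cdot> w = a"
    then have "v \<cdot> a = v \<cdot> u \<cdot> w"
      using uD vD by (auto simp: homset_def Cmp_assoc_Arr)
    then show "w = v \<cdot> a"
      using v w by (auto simp: homset_def arr_simps)
  qed
  then show ?thesis
    using uD by (auto simp: fibre_square_def arr_simps homset_def)
qed

text \<open>
  The kernel pair of an isomorphism is trivial. The projection formula for this square is what
  relates \<open>u\<^sub>*\<close> to the product with \<open>\<theta>(u)\<close>.
\<close>
lemma fibre_square_iso_Idn:
  assumes "u \<in> homset V X Y" "iso_arr V u"
  shows "fibre_square V u u (Idn V X) (Idn V X)"
proof -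
  note uD = homsetD[OF assms(1)]
  obtain v where v: "v \<in> homset V Y X" "v \<cdot> u = Idn V X" "u \<cdot> v = Idn V Y"
    using assms(2,1) by (rule iso_arrE)
  have mono: "a = b" if a: "a \<in> homset V T X" and b: "b \<in> homset V T X" and "u \<cdot> a = u \<cdot> b" for T a b
  proof -
    have "v \<cdot> u \<cdot> a = v \<cdot> u \<cdot> b"
      using uD homsetD[OF v(1)] homsetD[OF a] homsetD[OF b] that(3) by (simp add: Cmp_assoc_Arr)
    then show ?thesis
      using homsetD[OF a] homsetD[OF b] v(2) by (simp add: arr_simps)
  qed
  have "\<exists>!w. w \<in> homset V T X \<and> Idn V X \<cdot> w = a \<and> Idn V X \<cdot> w = b"
    if "a \<in> homset V T X" "b \<in> homset V T X" "u \<cdot> a = u \<cdot> b" for T a b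
    using mono[OF that] that(1) by (intro ex1I[of _ a]) (auto simp: Idn_Cmp)
  then show ?thesis
    unfolding fibre_square_def using uD by (simp add: arr_simps)
qed

end

context bivariant_data
begin

lemma iso_arr_Conf_Spec:
  assumes "u \<in> homset D X Y" "iso_arr D u"
  shows "u \<in> Conf D" "u \<in> Spec D"
  using fibre_square_Idn_iso[OF assms] Conf_base_change Conf_Idn Spec_base_change Spec_Idn
    homsetD(5)[OF assms(1)] by blast+

lemma fprodE:
  assumes "f \<in> homset D X Z" "g \<in> homset D Y Z"
  obtains f' g' where "fprod D f g = (f', g')" "fibre_square D f g f' g'"
proof -
  have "\<exists>p. case p of (f', g') \<Rightarrow> fibre_square D f g f' g'"
    using fibre_products[OF assms] by auto
  then have "case fprod D f g of (f', g') \<Rightarrow> fibre_square D f g f' g'"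
    unfolding fprod_def by (rule someI_ex)
  then show thesis
    using that by (cases "fprod D f g") simp
qed

lemma trm_hom: "X \<in> Obj D \<Longrightarrow> trm D X \<in> homset D X (pt D)"
  unfolding trm_def using pt_final by (rule theI')

lemma trm_unique:
  assumes "f \<in> homset D X (pt D)"
  shows "f = trm D X"
  using pt_final[OF homsetD(4)[OF assms]] trm_hom[OF homsetD(4)[OF assms]] assms by blast

lemma trm_Cmp:
  assumes "f \<in> homset D X Y"
  shows "trm D Y \<cdot> f = trm D X"
  by (rule trm_unique[OF Cmp_hom[OF assms trm_hom[OF homsetD(5)[OF assms]]]])

text \<open>
  The square is the exterior square of \<open>X \<rightarrow> pt\<close> and \<open>Y \<rightarrow> pt\<close>, once \<open>Y\<close> is read as a product
  \<open>pt \<times> Y\<close>, \<open>X\<close> as a product \<open>X \<times> pt\<close> and \<open>pt\<close> as \<open>pt \<times> pt\<close>.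
\<close>
lemma product_square_indep:
  assumes ext: "exterior_squares_independent D" and pq: "is_product D p q"
  shows "indep D (trm D (Cod D p)) (trm D (Cod D q)) q p"
proof -
  note sq = fibre_squareD[OF pq[unfolded is_product_def]]
  define X Y where "X = Cod D p" and "Y = Cod D q"
  have X: "X \<in> Obj D" and Y: "Y \<in> Obj D"
    using sq Cod_Obj by (simp_all add: X_def Y_def)
  note tX = trm_hom[OF X] and tY = trm_hom[OF Y] and IX = Idn_hom[OF X] and IY = Idn_hom[OF Y]
  note Ip = Idn_hom[OF pt_Obj]
  have p: "p \<in> homset D (Dom D p) X" and q: "q \<in> homset D (Dom D p) Y"
    using sq by (simp_all add: homset_def X_def Y_def)
  have tpt: "trm D (pt D) = Idn D (pt D)"
    using trm_unique[OF Ip] by simp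
  note dc = homsetD(2,3)[OF tX] homsetD(2,3)[OF tY] homsetD(2,3)[OF IX] homsetD(2,3)[OF IY]
    homsetD(2,3)[OF Ip] homsetD(3)[OF p] homsetD(2,3)[OF q]
  have P1: "is_product D (trm D Y) (Idn D Y)"
    using indep_fibre_square[OF indep_Idn_vertical[OF tY]] unfolding is_product_def dc tpt .
  have P2: "is_product D (Idn D X) (trm D X)"
    using indep_fibre_square[OF indep_Idn_horizontal[OF tX]] unfolding is_product_def dc tpt .
  have P3: "is_product D (Idn D (pt D)) (Idn D (pt D))"
    using indep_fibre_square[OF indep_Idn_horizontal[OF Ip]] unfolding is_product_def dc tpt .
  have "product_arr D (trm D X) (Idn D Y) (p, q) (trm D Y, Idn D Y) q"
    unfolding product_arr_def prod.case dc trm_Cmp[OF p] trm_Cmp[OF q]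
    using pq P1 tX IY q by (intro conjI refl)
  moreover have "product_arr D (trm D X) (Idn D (pt D)) (Idn D X, trm D X) (Idn D (pt D), Idn D (pt D)) (trm D X)"
    unfolding product_arr_def prod.case dc Cmp_Idn[OF tX] Idn_Cmp[OF tX]
    using P2 P3 tX Ip by (intro conjI refl)
  moreover have "product_arr D (Idn D X) (trm D Y) (p, q) (Idn D X, trm D X) p"
    unfolding product_arr_def prod.case dc trm_Cmp[OF p] trm_Cmp[OF q]
    using pq P2 tY IX p by (intro conjI refl)
  moreover have "product_arr D (Idn D (pt D)) (trm D Y) (trm D Y, Idn D Y) (Idn D (pt D), Idn D (pt D)) (trm D Y)"
    unfolding product_arr_def prod.case dc Cmp_Idn[OF tY] Idn_Cmp[OF tY]
    using P1 P3 tY Ip by (intro conjI refl)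
  ultimately have "indep D (trm D X) (trm D Y) q p"
    using ext[unfolded exterior_squares_independent_def] tX tY by blast
  then show ?thesis
    unfolding X_def Y_def .
qed

end


section \<open>Pullback of fiber-objects\<close>

context bivariant_data
begin

lemma fib_Obj: "L \<in> fib D X \<Longrightarrow> L \<in> Obj (tot D)" "L \<in> fib D X \<Longrightarrow> prO D L = X"
  by (auto simp: fib_def)

interpretation tot: category "tot D"
  by (rule tot_category)

lemma fib_iso_refl: "L \<in> fib D X \<Longrightarrow> fib_iso D L L"
  unfolding fib_iso_def
  by (intro bexI[of _ "Idn (tot D) L"]) (auto simp: fib_def tot.Idn_hom tot.iso_arr_Idn prA_Idn)

lemma fib_iso_fib: "fib_iso D L L' \<Longrightarrow> L \<in> fib D X \<Longrightarrow> L' \<in> fib D X"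
  unfolding fib_iso_def by (auto simp: fib_def dest: tot.homsetD)

lemma fib_iso_sym:
  assumes "fib_iso D L L'"
  shows "fib_iso D L' L"
proof -
  obtain e where e: "e \<in> homset (tot D) L L'" "iso_arr (tot D) e" "prO D L = prO D L'"
      "prA D e = Idn D (prO D L)"
    using assms by (auto simp: fib_iso_def)
  obtain d where d: "d \<in> homset (tot D) L' L" "d \<cdot>\<^bsub>tot D\<^esub> e = Idn (tot D) L" "iso_arr (tot D) d"
    using e(2,1) by (rule tot.iso_arrE)
  have "prA D d = prA D d \<cdot> prA D e"
    using prA_hom[OF d(1)] e by (simp add: Cmp_Idn)
  also have "\<dots> = Idn D (prO D L')"
    using prA_Cmp[OF e(1) d(1)] d(2) e prA_Idn tot.homsetD[OF e(1)] by simp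
  finally show ?thesis
    using d e(3) unfolding fib_iso_def by auto
qed

lemma fib_iso_trans:
  assumes "fib_iso D L L'" "fib_iso D L' L''"
  shows "fib_iso D L L''"
proof -
  obtain e where e: "e \<in> homset (tot D) L L'" "iso_arr (tot D) e" "prO D L = prO D L'"
      "prA D e = Idn D (prO D L)"
    using assms(1) by (auto simp: fib_iso_def)
  obtain d where d: "d \<in> homset (tot D) L' L''" "iso_arr (tot D) d" "prO D L' = prO D L''"
      "prA D d = Idn D (prO D L')"
    using assms(2) by (auto simp: fib_iso_def)
  have "prA D (d \<cdot>\<^bsub>tot D\<^esub> e) = Idn D (prO D L)"
    using prA_Cmp[OF e(1) d(1)] e d prA_hom[OF e(1)] by (simp add: Idn_Cmp)
  then show ?thesis
    using tot.Cmp_hom[OF e(1) d(1)] tot.iso_arr_Cmp[OF e(2,1) d(2,1)] e(3) d(3)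
    unfolding fib_iso_def by auto
qed

lemma cartesianE:
  assumes "cartesian D e" "e \<in> homset (tot D) L M" "d \<in> homset (tot D) K M"
    "h \<in> homset D (prO D K) (prO D L)" "prA D d = prA D e \<cdot> h"
  obtains k where "k \<in> homset (tot D) K L" "prA D k = h" "e \<cdot>\<^bsub>tot D\<^esub> k = d"
    "\<forall>k'. k' \<in> homset (tot D) K L \<and> prA D k' = h \<and> e \<cdot>\<^bsub>tot D\<^esub> k' = d \<longrightarrow> k' = k"
proof -
  have "\<exists>!k. k \<in> homset (tot D) K L \<and> prA D k = h \<and> e \<cdot>\<^bsub>tot D\<^esub> k = d"
    using assms unfolding cartesian_def homset_def[of "tot D"] by force
  then obtain k where k: "k \<in> homset (tot D) K L \<and> prA D k = h \<and> e \<cdot>\<^bsub>tot D\<^esub> k = d"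
    and uniq: "\<forall>k'. k' \<in> homset (tot D) K L \<and> prA D k' = h \<and> e \<cdot>\<^bsub>tot D\<^esub> k' = d \<longrightarrow> k' = k"
    by (rule ex1E)
  show thesis using k by (intro that[OF _ _ _ uniq]) simp_all
qed

lemma cartesianI:
  assumes "e \<in> homset (tot D) L M"
    and "\<And>K d h. d \<in> homset (tot D) K M \<Longrightarrow> h \<in> homset D (prO D K) (prO D L) \<Longrightarrow>
      prA D d = prA D e \<cdot> h \<Longrightarrow>
      \<exists>!k. k \<in> homset (tot D) K L \<and> prA D k = h \<and> e \<cdot>\<^bsub>tot D\<^esub> k = d"
  shows "cartesian D e"
  using assms unfolding cartesian_def by (auto simp: homset_def[of "tot D"])

lemma cartesian_Cmp:
  assumes e: "e \<in> homset (tot D) L M" "cartesian D e"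
    and e': "e' \<in> homset (tot D) M N" "cartesian D e'"
  shows "cartesian D (e' \<cdot>\<^bsub>tot D\<^esub> e)"
proof (rule cartesianI[OF tot.Cmp_hom[OF e(1) e'(1)]])
  fix K d h assume d: "d \<in> homset (tot D) K N" and h: "h \<in> homset D (prO D K) (prO D L)"
    and eq: "prA D d = prA D (e' \<cdot>\<^bsub>tot D\<^esub> e) \<cdot> h"
  have eq': "prA D d = prA D e' \<cdot> (prA D e \<cdot> h)"
    using eq prA_Cmp[OF e(1) e'(1)] Cmp_assoc[OF h prA_hom[OF e(1)] prA_hom[OF e'(1)]] by simp
  obtain m where m: "m \<in> homset (tot D) K M" "prA D m = prA D e \<cdot> h" "e' \<cdot>\<^bsub>tot D\<^esub> m = d"
      "\<forall>k'. k' \<in> homset (tot D) K M \<and> prA D k' = prA D e \<cdot> h \<and> e' \<cdot>\<^bsub>tot D\<^esub> k' = d \<longrightarrow> k' = m"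
    by (rule cartesianE[OF e'(2,1) d Cmp_hom[OF h prA_hom[OF e(1)]] eq'])
  obtain k where k: "k \<in> homset (tot D) K L" "prA D k = h" "e \<cdot>\<^bsub>tot D\<^esub> k = m"
      "\<forall>k'. k' \<in> homset (tot D) K L \<and> prA D k' = h \<and> e \<cdot>\<^bsub>tot D\<^esub> k' = m \<longrightarrow> k' = k"
    by (rule cartesianE[OF e(2,1) m(1) h m(2)])
  show "\<exists>!k. k \<in> homset (tot D) K L \<and> prA D k = h \<and> e' \<cdot>\<^bsub>tot D\<^esub> e \<cdot>\<^bsub>tot D\<^esub> k = d"
  proof (rule ex1I[of _ k])
    show "k \<in> homset (tot D) K L \<and> prA D k = h \<and> e' \<cdot>\<^bsub>tot D\<^esub> e \<cdot>\<^bsub>tot D\<^esub> k = d"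
      using k(1-3) m(3) tot.Cmp_assoc[OF k(1) e(1) e'(1)] by simp
    fix k' assume k': "k' \<in> homset (tot D) K L \<and> prA D k' = h \<and> e' \<cdot>\<^bsub>tot D\<^esub> e \<cdot>\<^bsub>tot D\<^esub> k' = d"
    from k' have k'1: "k' \<in> homset (tot D) K L" and k'2: "prA D k' = h"
      and k'3: "e' \<cdot>\<^bsub>tot D\<^esub> e \<cdot>\<^bsub>tot D\<^esub> k' = d" by simp_all
    have "e \<cdot>\<^bsub>tot D\<^esub> k' = m"
      using tot.Cmp_hom[OF k'1 e(1)] prA_Cmp[OF k'1 e(1)] tot.Cmp_assoc[OF k'1 e(1) e'(1)] k'2 k'3
      by (intro m(4)[THEN spec, THEN mp]) simp
    with k'1 k'2 have "k' \<in> homset (tot D) K L \<and> prA D k' = h \<and> e \<cdot>\<^bsub>tot D\<^esub> k' = m"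
      by simp
    then show "k' = k"
      by (rule k(4)[THEN spec, THEN mp])
  qed
qed

lemma cartesian_iso:
  assumes e: "e \<in> homset (tot D) L M" and "iso_arr (tot D) e"
  shows "cartesian D e"
proof (rule cartesianI[OF e])
  obtain i where i: "i \<in> homset (tot D) M L" "i \<cdot>\<^bsub>tot D\<^esub> e = Idn (tot D) L"
      "e \<cdot>\<^bsub>tot D\<^esub> i = Idn (tot D) M"
    using assms(2,1) by (rule tot.iso_arrE)
  fix K d h assume d: "d \<in> homset (tot D) K M" and h: "h \<in> homset D (prO D K) (prO D L)"
    and eq: "prA D d = prA D e \<cdot> h"
  have "prA D (i \<cdot>\<^bsub>tot D\<^esub> d) = (prA D i \<cdot> prA D e) \<cdot> h"
    using prA_Cmp[OF d i(1)] Cmp_assoc[OF h prA_hom[OF e] prA_hom[OF i(1)]] eq by simp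
  also have "prA D i \<cdot> prA D e = Idn D (prO D L)"
    using prA_Cmp[OF e i(1)] i(2) prA_Idn[OF tot.homsetD(4)[OF e]] by simp
  also have "\<dots> \<cdot> h = h"
    using h by (rule Idn_Cmp)
  finally have ih: "prA D (i \<cdot>\<^bsub>tot D\<^esub> d) = h" .
  show "\<exists>!k. k \<in> homset (tot D) K L \<and> prA D k = h \<and> e \<cdot>\<^bsub>tot D\<^esub> k = d"
  proof (rule ex1I[of _ "i \<cdot>\<^bsub>tot D\<^esub> d"])
    show "i \<cdot>\<^bsub>tot D\<^esub> d \<in> homset (tot D) K L \<and> prA D (i \<cdot>\<^bsub>tot D\<^esub> d) = h \<and> e \<cdot>\<^bsub>tot D\<^esub> (i \<cdot>\<^bsub>tot D\<^esub> d) = d"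
      using ih i d tot.Cmp_hom[OF d i(1)] tot.Cmp_assoc[OF d i(1) e] by (simp add: tot.Idn_Cmp)
    fix k assume k: "k \<in> homset (tot D) K L \<and> prA D k = h \<and> e \<cdot>\<^bsub>tot D\<^esub> k = d"
    then show "k = i \<cdot>\<^bsub>tot D\<^esub> d"
      using tot.Cmp_assoc[of k K L e M i L] e i by (auto simp: tot.Idn_Cmp)
  qed
qed

lemma fpull_cartesian:
  assumes f: "f \<in> homset D X Y" and L: "L \<in> fib D Y"
  obtains e where "e \<in> homset (tot D) (fpull D f L) L" "cartesian D e" "prA D e = f"
proof -
  have "\<exists>L'. \<exists>e\<in>homset (tot D) L' L. cartesian D e \<and> prA D e = f"
    using cartesian_lift[OF f L] by (auto simp: homset_def)
  from someI_ex[OF this] show thesis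
    using that unfolding fpull_def by blast
qed

lemma fpull_fib:
  assumes f: "f \<in> homset D X Y" and L: "L \<in> fib D Y"
  shows "fpull D f L \<in> fib D X"
proof -
  obtain e where e: "e \<in> homset (tot D) (fpull D f L) L" "cartesian D e" "prA D e = f"
    by (rule fpull_cartesian[OF assms])
  from this(1,3) have "prO D (fpull D f L) = X"
    using prA_hom[OF e(1)] f by (auto simp: homset_def)
  then show ?thesis
    using e tot.homsetD[OF e(1)] by (auto simp: fib_def)
qed

text \<open>
  Two cartesian arrows over the same arrow factor through each other over the identity; the
  composites are identities because each arrow has only one factorization through itself.
\<close>
lemma cartesian_unique:
  assumes e: "e \<in> homset (tot D) L N" "cartesian D e"
    and e': "e' \<in> homset (tot D) M N" "cartesian D e'" and eq: "prA D e = prA D e'"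
  shows "fib_iso D L M"
proof -
  have pr: "prO D L = prO D M"
    using prA_hom[OF e(1)] prA_hom[OF e'(1)] eq by (auto simp: homset_def)
  have L: "L \<in> Obj (tot D)" and M: "M \<in> Obj (tot D)"
    using tot.homsetD[OF e(1)] tot.homsetD[OF e'(1)] by auto
  note oL = prO_Obj[OF L] and oM = prO_Obj[OF M]
  have pL: "prA D e = prA D e' \<cdot> Idn D (prO D L)" and pM: "prA D e' = prA D e \<cdot> Idn D (prO D L)"
    using prA_hom[OF e(1)] prA_hom[OF e'(1)] eq pr by (auto simp: Cmp_Idn)
  have I: "Idn D (prO D L) \<in> homset D (prO D L) (prO D M)"
      "Idn D (prO D L) \<in> homset D (prO D M) (prO D L)"
    using Idn_hom[OF oL] pr by auto
  obtain k where k: "k \<in> homset (tot D) L M" "prA D k = Idn D (prO D L)" "e' \<cdot>\<^bsub>tot D\<^esub> k = e"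
    by (rule cartesianE[OF e'(2,1) e(1) I(1) pL])
  obtain m where m: "m \<in> homset (tot D) M L" "prA D m = Idn D (prO D L)" "e \<cdot>\<^bsub>tot D\<^esub> m = e'"
    by (rule cartesianE[OF e(2,1) e'(1) I(2) pM])
  have uniq: "i = Idn (tot D) K"
    if d: "d \<in> homset (tot D) K N" "cartesian D d" and i: "i \<in> homset (tot D) K K"
      "prA D i = Idn D (prO D K)" "d \<cdot>\<^bsub>tot D\<^esub> i = d" for d K i
  proof -
    note K = tot.homsetD(4)[OF d(1)]
    have "prA D d = prA D d \<cdot> Idn D (prO D K)"
      using prA_hom[OF d(1)] by (simp add: Cmp_Idn)
    then obtain k where k: "\<forall>k'. k' \<in> homset (tot D) K K \<and> prA D k' = Idn D (prO D K) \<and>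
        d \<cdot>\<^bsub>tot D\<^esub> k' = d \<longrightarrow> k' = k"
      by (rule cartesianE[OF d(2,1,1) Idn_hom[OF prO_Obj[OF K]]])
    have "i = k"
      by (rule k[THEN spec, THEN mp]) (simp add: i)
    moreover have "Idn (tot D) K = k"
      by (rule k[THEN spec, THEN mp]) (simp add: tot.Idn_hom[OF K] prA_Idn[OF K] tot.Cmp_Idn[OF d(1)])
    ultimately show ?thesis by simp
  qed
  have I2: "Idn D (prO D L) \<cdot> Idn D (prO D L) = Idn D (prO D L)"
    using I pr by (auto simp: Cmp_Idn)
  have "m \<cdot>\<^bsub>tot D\<^esub> k = Idn (tot D) L"
    using k(2,3) m(2,3) I2 prA_Cmp[OF k(1) m(1)] tot.Cmp_assoc[OF k(1) m(1) e(1)] tot.Cmp_hom[OF k(1) m(1)]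
    by (intro uniq[OF e]) simp_all
  moreover have "k \<cdot>\<^bsub>tot D\<^esub> m = Idn (tot D) M"
    using k(2,3) m(2,3) I2 prA_Cmp[OF m(1) k(1)] tot.Cmp_assoc[OF m(1) k(1) e'(1)] tot.Cmp_hom[OF m(1) k(1)] pr
    by (intro uniq[OF e']) simp_all
  ultimately have "iso_arr (tot D) k"
    using k(1) m(1) by (intro tot.iso_arrI)
  then show ?thesis
    unfolding fib_iso_def using k(1,2) pr by (intro bexI[of _ k] conjI)
qed

lemma fpull_cong:
  assumes f: "f \<in> homset D X Y" and L: "L \<in> fib D Y" and "fib_iso D L M"
  shows "fib_iso D (fpull D f L) (fpull D f M)"
proof -
  note M = fib_iso_fib[OF assms(3) L]
  obtain i where i: "i \<in> homset (tot D) L M" "iso_arr (tot D) i" "prA D i = Idn D (prO D L)"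
    using assms(3) by (auto simp: fib_iso_def)
  obtain e where e: "e \<in> homset (tot D) (fpull D f L) L" "cartesian D e" and ef: "prA D e = f"
    by (rule fpull_cartesian[OF f L])
  obtain e' where e': "e' \<in> homset (tot D) (fpull D f M) M" "cartesian D e'" "prA D e' = f"
    by (rule fpull_cartesian[OF f M])
  have "prA D (i \<cdot>\<^bsub>tot D\<^esub> e) = f"
    using prA_Cmp[OF e(1) i(1)] ef i(3) f fib_Obj(2)[OF L] by (simp add: Idn_Cmp)
  then have "prA D (i \<cdot>\<^bsub>tot D\<^esub> e) = prA D e'"
    using e'(3) by simp
  with cartesian_Cmp[OF e i(1) cartesian_iso[OF i(1,2)]] show ?thesis
    by (rule cartesian_unique[OF tot.Cmp_hom[OF e(1) i(1)] _ e'(1,2)])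
qed

lemma fpull_Idn:
  assumes L: "L \<in> fib D X"
  shows "fib_iso D (fpull D (Idn D X) L) L"
proof -
  have X: "X \<in> Obj D" and LO: "L \<in> Obj (tot D)"
    using L prO_Obj by (auto simp: fib_def)
  obtain e where e: "e \<in> homset (tot D) (fpull D (Idn D X) L) L" "cartesian D e" "prA D e = Idn D X"
    by (rule fpull_cartesian[OF Idn_hom[OF X] L])
  show ?thesis
    using prA_Idn[OF LO] e(3) fib_Obj(2)[OF L]
    by (intro cartesian_unique[OF e(1,2) tot.Idn_hom[OF LO]]
        cartesian_iso[OF tot.Idn_hom[OF LO] tot.iso_arr_Idn[OF LO]]) simp
qed

text \<open>
  The composite of the two chosen cartesian arrows is cartesian over \<open>g \<cdot> f\<close>, as is the chosen
  one for \<open>g \<cdot> f\<close>.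
\<close>
lemma fpull_Cmp:
  assumes f: "f \<in> homset D X Y" and g: "g \<in> homset D Y Z" and L: "L \<in> fib D Z"
  shows "fib_iso D (fpull D f (fpull D g L)) (fpull D (g \<cdot> f) L)"
proof -
  note gL = fpull_fib[OF g L]
  obtain e where e: "e \<in> homset (tot D) (fpull D g L) L" "cartesian D e" "prA D e = g"
    by (rule fpull_cartesian[OF g L])
  obtain d where d: "d \<in> homset (tot D) (fpull D f (fpull D g L)) (fpull D g L)" "cartesian D d"
      "prA D d = f"
    by (rule fpull_cartesian[OF f gL])
  obtain c where c: "c \<in> homset (tot D) (fpull D (g \<cdot> f) L) L" "cartesian D c" "prA D c = g \<cdot> f"
    by (rule fpull_cartesian[OF Cmp_hom[OF f g] L])
  show ?thesis
    using prA_Cmp[OF d(1) e(1)] c(3) e(3) d(3)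
    by (intro cartesian_unique[OF tot.Cmp_hom[OF d(1) e(1)] cartesian_Cmp[OF d(1,2) e(1,2)] c(1,2)]) simp
qed

end


section \<open>Isomorphism classes of cobordism cycles\<close>

text \<open>
  The cycles whose isomorphism classes are the generators of \<open>OM(f)\<close>.
\<close>
definition om_cycles :: "('o, 'm, 'l, 'e) bicat \<Rightarrow> 'm \<Rightarrow> ('m, 'l) cycle set"
  where "om_cycles D f = {(h, Ls) \<in> cycles D (Dom D f). h \<in> Conf D \<and> f \<cdot>\<^bsub>D\<^esub> h \<in> Spec D}"

context bivariant_data
begin

lemma cyclesD:
  assumes "(h, Ls) \<in> cycles D X"
  shows "h \<in> homset D (Dom D h) X" "h \<in> Arr D" "Cod D h = X" "set Ls \<subseteq> fib D (Dom D h)"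
  using assms by (auto simp: cycles_def homset_def)

lemma cyclesI: "h \<in> homset D Y X \<Longrightarrow> set Ls \<subseteq> fib D Y \<Longrightarrow> (h, Ls) \<in> cycles D X"
  by (auto simp: cycles_def homset_def)

lemma nth_fib: "set Ls \<subseteq> fib D X \<Longrightarrow> i < length Ls \<Longrightarrow> Ls ! i \<in> fib D X"
  by (meson nth_mem subsetD)

lemma map_fpull_fib:
  assumes "f \<in> homset D X Y" "set Ls \<subseteq> fib D Y"
  shows "set (map (fpull D f) Ls) \<subseteq> fib D X"
  using fpull_fib[OF assms(1)] assms(2) by auto

lemma cycle_isoI:
  assumes "u \<in> homset D (Dom D h) (Dom D k)" "iso_arr D u" "k \<cdot> u = h"
    "length Ls = length Ms" "\<sigma> permutes {..<length Ls}"
    "\<And>i. i < length Ls \<Longrightarrow> fib_iso D (Ls ! i) (fpull D u (Ms ! \<sigma> i))"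
  shows "cycle_iso D (h, Ls) (k, Ms)"
  using assms unfolding cycle_iso_def by blast

lemma cycle_isoE:
  assumes "cycle_iso D (h, Ls) (k, Ms)"
  obtains u \<sigma> where "u \<in> homset D (Dom D h) (Dom D k)" "iso_arr D u" "k \<cdot> u = h"
    "length Ls = length Ms" "\<sigma> permutes {..<length Ls}"
    "\<forall>i < length Ls. fib_iso D (Ls ! i) (fpull D u (Ms ! \<sigma> i))"
  using assms unfolding cycle_iso_def by blast

lemma cycle_iso_pull:
  assumes z: "(h, Ls) \<in> cycles D X" and u: "u \<in> homset D Y (Dom D h)" "iso_arr D u"
  shows "cycle_iso D (h \<cdot> u, map (fpull D u) Ls) (h, Ls)"
proof -
  have "fpull D u (Ls ! i) \<in> fib D Y" if "i < length Ls" for i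
    using nth_fib[OF cyclesD(4)[OF z] that] by (rule fpull_fib[OF u(1)])
  then show ?thesis
    using homsetD[OF u(1)] cyclesD(2)[OF z] u
    by (intro cycle_isoI[where u = u and \<sigma> = id]) (auto simp: permutes_id arr_simps intro: fib_iso_refl)
qed

lemma cycle_iso_refl:
  assumes z: "(h, Ls) \<in> cycles D X"
  shows "cycle_iso D (h, Ls) (h, Ls)"
proof -
  have X: "Dom D h \<in> Obj D"
    using cyclesD(2)[OF z] Dom_Obj by simp
  have "fib_iso D (Ls ! i) (fpull D (Idn D (Dom D h)) (Ls ! i))" if "i < length Ls" for i
    using nth_fib[OF cyclesD(4)[OF z] that] by (intro fib_iso_sym[OF fpull_Idn])
  then show ?thesis
    using X cyclesD(1,2)[OF z]
    by (intro cycle_isoI[where u = "Idn D (Dom D h)" and \<sigma> = id])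
      (auto simp: permutes_id Idn_hom iso_arr_Idn Cmp_Idn)
qed

lemma cycle_iso_sym:
  assumes z: "(h, Ls) \<in> cycles D X" and w: "(k, Ms) \<in> cycles D Y"
    and iso: "cycle_iso D (h, Ls) (k, Ms)"
  shows "cycle_iso D (k, Ms) (h, Ls)"
proof -
  obtain u \<sigma> where u: "u \<in> homset D (Dom D h) (Dom D k)" "iso_arr D u" "k \<cdot> u = h"
    and len: "length Ls = length Ms" and \<sigma>: "\<sigma> permutes {..<length Ls}"
    and fib: "\<forall>i < length Ls. fib_iso D (Ls ! i) (fpull D u (Ms ! \<sigma> i))"
    using iso by (rule cycle_isoE) 
  obtain v where v: "v \<in> homset D (Dom D k) (Dom D h)" "v \<cdot> u = Idn D (Dom D h)"
      "u \<cdot> v = Idn D (Dom D k)" "iso_arr D v"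
    using u(2,1) by (rule iso_arrE)
  \<comment> \<open>The notation \<open>inv\<close> is taken by the inverse in a group, hence \<open>inv_into UNIV\<close>.\<close>
  have "fib_iso D (Ms ! j) (fpull D v (Ls ! inv_into UNIV \<sigma> j))" if "j < length Ms" for j
  proof -
    define i where "i = inv_into UNIV \<sigma> j"
    have i: "i < length Ls" "\<sigma> i = j"
      using that len permutes_in_image[OF permutes_inv[OF \<sigma>]] permutes_inverses(1)[OF \<sigma>]
      by (auto simp: i_def)
    have Ls: "Ls ! i \<in> fib D (Dom D h)" and Ms: "Ms ! j \<in> fib D (Dom D k)"
      using nth_fib[OF cyclesD(4)[OF z]] nth_fib[OF cyclesD(4)[OF w]] i that by auto
    have "fib_iso D (fpull D v (Ls ! i)) (fpull D v (fpull D u (Ms ! j)))"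
      using fpull_cong[OF v(1) Ls fib[rule_format, OF i(1)]] i by simp
    also have "fib_iso D \<dots> (fpull D (Idn D (Dom D k)) (Ms ! j))"
      using fpull_Cmp[OF v(1) u(1) Ms] v(3) by simp
    also (fib_iso_trans) have "fib_iso D \<dots> (Ms ! j)"
      using Ms by (rule fpull_Idn)
    finally (fib_iso_trans) show ?thesis
      unfolding i_def by (rule fib_iso_sym)
  qed
  moreover have "k \<cdot> u \<cdot> v = k"
    using v(3) homsetD[OF u(1)] homsetD[OF v(1)] cyclesD(2)[OF w]
    by (simp add: Cmp_assoc_Arr Cmp_Idn_Arr)
  ultimately show ?thesis
    using v(1,4) u(3) permutes_inv[OF \<sigma>] len
    by (intro cycle_isoI[where u = v and \<sigma> = "inv_into UNIV \<sigma>"]) simp_all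
qed

lemma cycle_iso_trans:
  assumes z: "(h, Ls) \<in> cycles D X" and w: "(k, Ms) \<in> cycles D Y" and y: "(l, Ns) \<in> cycles D Z"
    and iso1: "cycle_iso D (h, Ls) (k, Ms)" and iso2: "cycle_iso D (k, Ms) (l, Ns)"
  shows "cycle_iso D (h, Ls) (l, Ns)"
proof -
  obtain u \<sigma> where u: "u \<in> homset D (Dom D h) (Dom D k)" "iso_arr D u" "k \<cdot> u = h"
    and len: "length Ls = length Ms" and \<sigma>: "\<sigma> permutes {..<length Ls}"
    and fib: "\<forall>i < length Ls. fib_iso D (Ls ! i) (fpull D u (Ms ! \<sigma> i))"
    using iso1 by (rule cycle_isoE)
  obtain v \<tau> where v: "v \<in> homset D (Dom D k) (Dom D l)" "iso_arr D v" "l \<cdot> v = k"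
    and len': "length Ms = length Ns" and \<tau>: "\<tau> permutes {..<length Ms}"
    and fib': "\<forall>i < length Ms. fib_iso D (Ms ! i) (fpull D v (Ns ! \<tau> i))"
    using iso2 by (rule cycle_isoE)
  have "fib_iso D (Ls ! i) (fpull D (v \<cdot> u) (Ns ! (\<tau> \<circ> \<sigma>) i))" if i: "i < length Ls" for i
  proof -
    have si: "\<sigma> i < length Ms" and ti: "\<tau> (\<sigma> i) < length Ns"
      using i len len' permutes_in_image[OF \<sigma>] permutes_in_image[OF \<tau>] by auto
    have Ms: "Ms ! \<sigma> i \<in> fib D (Dom D k)" and Ns: "Ns ! \<tau> (\<sigma> i) \<in> fib D (Dom D l)"
      using nth_fib[OF cyclesD(4)[OF w] si] nth_fib[OF cyclesD(4)[OF y] ti] by auto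
    have "fib_iso D (Ls ! i) (fpull D u (Ms ! \<sigma> i))"
      using i fib by simp
    also have "fib_iso D \<dots> (fpull D u (fpull D v (Ns ! \<tau> (\<sigma> i))))"
      using fpull_cong[OF u(1) Ms fib'[rule_format, OF si]] .
    also (fib_iso_trans) have "fib_iso D \<dots> (fpull D (v \<cdot> u) (Ns ! \<tau> (\<sigma> i)))"
      using fpull_Cmp[OF u(1) v(1) Ns] .
    finally (fib_iso_trans) show ?thesis by simp
  qed
  moreover have "l \<cdot> (v \<cdot> u) = h"
    using u(3) v(3) homsetD[OF u(1)] homsetD[OF v(1)] cyclesD(2)[OF y]
    by (simp flip: Cmp_assoc_Arr)
  ultimately show ?thesis
    using Cmp_hom[OF u(1) v(1)] iso_arr_Cmp[OF u(2,1) v(2,1)] permutes_compose[OF \<sigma>] \<tau> len len'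
    by (intro cycle_isoI[where u = "v \<cdot> u" and \<sigma> = "\<tau> \<circ> \<sigma>"]) simp_all
qed

lemma cycle_iso_push:
  assumes z: "(h, Ls) \<in> cycles D X" and w: "(k, Ms) \<in> cycles D X" and f: "f \<in> homset D X Y"
    and iso: "cycle_iso D (h, Ls) (k, Ms)"
  shows "cycle_iso D (f \<cdot> h, Ls) (f \<cdot> k, Ms)"
proof -
  obtain u \<sigma> where u: "u \<in> homset D (Dom D h) (Dom D k)" "iso_arr D u" "k \<cdot> u = h"
    and len: "length Ls = length Ms" and \<sigma>: "\<sigma> permutes {..<length Ls}"
    and fib: "\<forall>i < length Ls. fib_iso D (Ls ! i) (fpull D u (Ms ! \<sigma> i))"
    using iso by (rule cycle_isoE)
  have "f \<cdot> k \<cdot> u = f \<cdot> h"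
    using u(3) homsetD[OF u(1)] homsetD[OF f] cyclesD(2,3)[OF w] by (simp add: Cmp_assoc_Arr)
  then show ?thesis
    using u(1,2) len \<sigma> fib homsetD[OF f] cyclesD(2,3)[OF z] cyclesD(2,3)[OF w]
    by (intro cycle_isoI[where u = u and \<sigma> = \<sigma>]) (simp_all add: Cmp_simps)
qed

lemma cyc_eqI:
  assumes z: "(h, Ls) \<in> cycles D X" and w: "(k, Ms) \<in> cycles D X"
    and iso: "cycle_iso D (h, Ls) (k, Ms)"
  shows "cyc D h Ls = cyc D k Ms"
proof -
  have "cycle_iso D (h, Ls) (l, Ns) \<longleftrightarrow> cycle_iso D (k, Ms) (l, Ns)"
    if y: "(l, Ns) \<in> cycles D X" for l Ns
    using cycle_iso_trans[OF z w y iso] cycle_iso_trans[OF w z y cycle_iso_sym[OF z w iso]] by blast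
  then show ?thesis
    unfolding cyc_def cyclesD(3)[OF z] cyclesD(3)[OF w] by auto
qed

lemma rep_cycE:
  assumes z: "(h, Ls) \<in> cycles D X"
  obtains k Ms where "rep (cyc D h Ls) = (k, Ms)" "(k, Ms) \<in> cycles D X"
    "cycle_iso D (h, Ls) (k, Ms)"
proof -
  have r: "rep (cyc D h Ls) \<in> cyc D h Ls"
    unfolding rep_def some_in_eq using z cycle_iso_refl[OF z] cyclesD(3)[OF z]
    by (auto simp: cyc_def)
  obtain k Ms where k: "rep (cyc D h Ls) = (k, Ms)"
    by (rule prod.exhaust)
  have "(k, Ms) \<in> cycles D X" "cycle_iso D (h, Ls) (k, Ms)"
    using r cyclesD(3)[OF z] unfolding k unfolding cyc_def by simp_all
  with k show thesis
    by (rule that)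
qed

lemma om_cyclesD:
  assumes f: "f \<in> homset D X Y" and z: "(h, Ls) \<in> om_cycles D f"
  shows "h \<in> homset D (Dom D h) X" "f \<cdot> h \<in> homset D (Dom D h) Y" "set Ls \<subseteq> fib D (Dom D h)"
    "h \<in> Conf D" "f \<cdot> h \<in> Spec D" "(h, Ls) \<in> cycles D X"
  using z f by (auto simp: om_cycles_def cycles_def homset_def Cmp_simps)

lemma om_cyclesI:
  assumes "f \<in> homset D X Y" "h \<in> homset D V X" "set Ls \<subseteq> fib D V" "h \<in> Conf D" "f \<cdot> h \<in> Spec D"
  shows "(h, Ls) \<in> om_cycles D f"
  using assms by (auto simp: om_cycles_def cycles_def homset_def)

lemma om_generatorsI: "(h, Ls) \<in> om_cycles D f \<Longrightarrow> cyc D h Ls \<in> om_generators D f"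
  by (auto simp: om_generators_def om_cycles_def)

text \<open>
  The operations of \<open>OM\<close> see a generator only through its representative, which satisfies
  the conditions on generators again because confined and specialized arrows are stable under
  composition with isomorphisms.
\<close>
lemma om_generatorsE:
  assumes f: "f \<in> homset D X Y" and c: "c \<in> om_generators D f"
  obtains h Ls where "rep c = (h, Ls)" "(h, Ls) \<in> om_cycles D f" "c = cyc D h Ls"
proof -
  obtain k Ms where k: "(k, Ms) \<in> om_cycles D f" "c = cyc D k Ms"
    using c by (auto simp: om_generators_def om_cycles_def)
  note kD = om_cyclesD[OF f k(1)]
  obtain h Ls where h: "rep c = (h, Ls)" "(h, Ls) \<in> cycles D X" "cycle_iso D (k, Ms) (h, Ls)"
    unfolding k(2) by (rule rep_cycE[OF kD(6)])
  obtain u \<sigma> where u: "u \<in> homset D (Dom D h) (Dom D k)" "iso_arr D u" "k \<cdot> u = h"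
    using cycle_iso_sym[OF kD(6) h(2,3)] by (rule cycle_isoE)
  note uC = iso_arr_Conf_Spec[OF u(1,2)]
  have "h \<in> Conf D"
    using Conf_Cmp[OF uC(1) kD(4)] u homsetD[OF u(1)] by simp
  moreover have "f \<cdot> h = f \<cdot> k \<cdot> u"
    using u(3) homsetD[OF u(1)] homsetD[OF f] homsetD[OF kD(1)] by (simp add: Cmp_assoc_Arr)
  then have "f \<cdot> h \<in> Spec D"
    using Spec_Cmp[OF uC(2) kD(5)] homsetD[OF u(1)] homsetD[OF kD(2)] by simp
  ultimately have om: "(h, Ls) \<in> om_cycles D f"
    using h(2) homsetD[OF f] by (simp add: om_cycles_def)
  have "c = cyc D h Ls"
    using cyc_eqI[OF kD(6) h(2,3)] k(2) by simp
  with h(1) om show thesis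
    by (rule that)
qed

lemma om_push_cycles:
  assumes f: "f \<in> homset D X Y" "f \<in> Conf D" and g: "g \<in> homset D Y Z"
    and z: "(h, Ls) \<in> om_cycles D (g \<cdot> f)"
  shows "(f \<cdot> h, Ls) \<in> om_cycles D g"
proof -
  note zD = om_cyclesD[OF Cmp_hom[OF f(1) g] z]
  have "f \<cdot> h \<in> Conf D"
    using Conf_Cmp[OF zD(4) f(2)] homsetD[OF zD(1)] homsetD[OF f(1)] by simp
  moreover have "g \<cdot> (f \<cdot> h) \<in> Spec D"
    using zD(5) Cmp_assoc[OF zD(1) f(1) g] by simp
  ultimately show ?thesis
    using om_cyclesI[OF g Cmp_hom[OF zD(1) f(1)] zD(3)] by simp
qed

lemma om_ori_cycles:
  assumes f: "f \<in> homset D X Y" and z: "(h, Ls) \<in> om_cycles D f" and L: "L \<in> fib D X"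
  shows "(h, Ls @ [fpull D h L]) \<in> om_cycles D f"
  using om_cyclesD[OF f z] fpull_fib[OF _ L, of h "Dom D h"] by (intro om_cyclesI[OF f]) auto

lemma om_pull_cycles:
  assumes sq: "indep D f g f' g'" and z: "(h, Ls) \<in> om_cycles D f" and sq': "fibre_square D h g' h' g''"
    and vert: "fibre_square D (f \<cdot> h) g (f' \<cdot> h') g''"
  shows "(h', map (fpull D g'') Ls) \<in> om_cycles D f'"
proof -
  note sqD = fibre_squareD[OF indep_fibre_square[OF sq]] and sqD' = fibre_squareD[OF sq']
  have f: "f \<in> homset D (Dom D f) (Cod D f)"
    using sqD by (simp add: homset_def)
  note zD = om_cyclesD[OF f z]
  have "f' \<in> homset D (Dom D f') (Cod D f')" "h' \<in> homset D (Dom D h') (Dom D f')"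
    "g'' \<in> homset D (Dom D h') (Dom D h)"
    using sqD sqD' by (simp_all add: homset_def)
  then show ?thesis
    using map_fpull_fib[OF _ zD(3)] Conf_base_change[OF zD(4) sq'] Spec_base_change[OF zD(5) vert]
    by (intro om_cyclesI)
qed

lemma om_prod_cycles:
  assumes f: "f \<in> homset D X Y" and g: "g \<in> homset D Y Z"
    and z: "(h, Ls) \<in> om_cycles D f" and w: "(k, Ms) \<in> om_cycles D g"
    and sq: "fibre_square D f k f' k'" and sq': "fibre_square D h k' h' k''"
    and vert: "fibre_square D (f \<cdot> h) k (f' \<cdot> h') k''"
  shows "(h \<cdot> k'', map (fpull D k'') Ls @ map (fpull D (f' \<cdot> h')) Ms) \<in> om_cycles D (g \<cdot> f)"
proof -
  note zD = om_cyclesD[OF f z] and wD = om_cyclesD[OF g w]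
  note hD = homsetD[OF zD(1)] and kD = homsetD[OF wD(1)] and fD = homsetD[OF f] and gD = homsetD[OF g]
  note sqD = fibre_squareD[OF sq] and sqD' = fibre_squareD[OF sq']
  have k'': "k'' \<in> homset D (Dom D h') (Dom D h)" and fh': "f' \<cdot> h' \<in> homset D (Dom D h') (Dom D k)"
    using sqD sqD' by (simp_all add: homset_def Cmp_simps)
  have "k' \<in> Conf D"
    using Conf_base_change[OF wD(4) fibre_square_sym[OF sq]] .
  then have k''C: "k'' \<in> Conf D"
    using Conf_base_change[OF _ fibre_square_sym[OF sq']] by simp
  have hkC: "h \<cdot> k'' \<in> Conf D"
    using Conf_Cmp[OF k''C zD(4)] sqD' by simp
  have "(g \<cdot> f) \<cdot> (h \<cdot> k'') = g \<cdot> ((f \<cdot> h) \<cdot> k'')"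
    using hD fD gD sqD' by (simp add: Cmp_assoc_Arr Cmp_simps)
  then have "(g \<cdot> f) \<cdot> (h \<cdot> k'') = (g \<cdot> k) \<cdot> (f' \<cdot> h')"
    unfolding fibre_squareD(9)[OF vert] using kD gD homsetD[OF fh'] by (simp add: Cmp_assoc_Arr)
  moreover have "(g \<cdot> k) \<cdot> (f' \<cdot> h') \<in> Spec D"
    using Spec_Cmp[OF Spec_base_change[OF zD(5) vert] wD(5)] homsetD[OF fh'] homsetD[OF wD(2)] by simp
  ultimately have "(g \<cdot> f) \<cdot> (h \<cdot> k'') \<in> Spec D"
    by simp
  then show ?thesis
    using map_fpull_fib[OF k'' zD(3)] map_fpull_fib[OF fh' wD(3)] hkC
    by (intro om_cyclesI[OF Cmp_hom[OF f g] Cmp_hom[OF k'' zD(1)]]) simp_all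
qed

lemma om_cycles_Idn:
  assumes "f \<in> homset D X Y" "f \<in> Spec D" "set Ls \<subseteq> fib D X"
  shows "(Idn D X, Ls) \<in> om_cycles D f"
  using assms Idn_hom[of X] Conf_Idn[of X] homsetD[OF assms(1)]
  by (intro om_cyclesI[OF assms(1) _ assms(3)]) (simp_all add: Cmp_Idn_Arr)

text \<open>
  The representative of \<open>[id; L\<^sub>1, \<dots>, L\<^sub>r]\<close> need not be the identity, but composing it with \<open>h\<close> gives
  a cycle isomorphic to \<open>(h; L\<^sub>1, \<dots>, L\<^sub>r)\<close>.
\<close>
lemma om_push_Idn:
  assumes f: "f \<in> homset D X Y" and z: "(h, Ls) \<in> om_cycles D f"
  shows "om_push D h f (frag_of (cyc D (Idn D (Dom D h)) Ls)) = frag_of (cyc D h Ls)"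
proof -
  note zD = om_cyclesD[OF f z]
  have I: "(Idn D (Dom D h), Ls) \<in> cycles D (Dom D h)"
    using zD(3) Idn_hom homsetD(4)[OF zD(1)] by (intro cyclesI) 
  obtain k Ms where k: "rep (cyc D (Idn D (Dom D h)) Ls) = (k, Ms)" "(k, Ms) \<in> cycles D (Dom D h)"
    "cycle_iso D (Idn D (Dom D h), Ls) (k, Ms)"
    by (rule rep_cycE[OF I])
  have "cycle_iso D (h, Ls) (h \<cdot> k, Ms)"
    using cycle_iso_push[OF I k(2) zD(1) k(3)] Cmp_Idn[OF zD(1)] by simp
  moreover have "(h \<cdot> k, Ms) \<in> cycles D X"
    using cyclesI[OF Cmp_hom[OF cyclesD(1)[OF k(2)] zD(1)] cyclesD(4)[OF k(2)]] .
  ultimately have "cyc D h Ls = cyc D (h \<cdot> k) Ms"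
    by (intro cyc_eqI[OF zD(6)])
  then show ?thesis
    by (simp add: om_push_def k(1))
qed

text \<open>
  The Gysin map \<open>h\<^sub>!\<close> of \<open>OM\<close> multiplies by \<open>\<theta>(h) = [id]\<close> before it pushes forward. The
  representative \<open>k\<close> of \<open>[id]\<close> is an isomorphism, so the two fibre products in the definition of
  the product pull back along isomorphisms and keep the isomorphism class.
\<close>
lemma om_prod_theta_Idn:
  assumes h: "h \<in> homset D X Y" and Ls: "set Ls \<subseteq> fib D X"
  shows "om_prod D (Idn D X) h (frag_of (cyc D (Idn D X) Ls)) (om_theta D h)
    = frag_of (cyc D (Idn D X) Ls)"
proof -
  note hD = homsetD[OF h]
  have I: "(Idn D X, Ls) \<in> cycles D X" and I0: "(Idn D X, []) \<in> cycles D X"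
    using Ls Idn_hom[OF hD(4)] by (simp_all add: cyclesI)
  obtain g Ms where g: "rep (cyc D (Idn D X) Ls) = (g, Ms)" "(g, Ms) \<in> cycles D X"
    "cycle_iso D (Idn D X, Ls) (g, Ms)"
    by (rule rep_cycE[OF I])
  obtain k Ns where k: "rep (cyc D (Idn D X) []) = (k, Ns)" "(k, Ns) \<in> cycles D X"
    "cycle_iso D (Idn D X, []) (k, Ns)"
    by (rule rep_cycE[OF I0])
  obtain u \<sigma> where u: "u \<in> homset D (Dom D (Idn D X)) (Dom D k)" "iso_arr D u" "k \<cdot> u = Idn D X"
    and len: "length ([] :: 'l list) = length Ns"
    using k(3) by (rule cycle_isoE)
  obtain v where v: "v \<in> homset D (Dom D k) (Dom D (Idn D X))" "u \<cdot> v = Idn D (Dom D k)" "iso_arr D v"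
    using u(2,1) by (rule iso_arrE)
  have "k = k \<cdot> (u \<cdot> v)"
    using v(2) Cmp_Idn[OF cyclesD(1)[OF k(2)]] by simp
  also have "\<dots> = k \<cdot> u \<cdot> v"
    using Cmp_assoc[OF v(1) u(1) cyclesD(1)[OF k(2)]] .
  also have "\<dots> = v"
    using homsetD[OF v(1)] hD(4) unfolding u(3) by (simp add: Idn_Cmp_Arr Idn_simps)
  finally have k_iso: "iso_arr D k"
    using v(3) by simp
  obtain f' k' where f': "fprod D (Idn D X) k = (f', k')" "fibre_square D (Idn D X) k f' k'"
    using Idn_hom[OF hD(4)] cyclesD(1)[OF k(2)] by (rule fprodE)
  have k': "k' \<in> homset D (Dom D k') X" "iso_arr D k'"
    using fibre_squareD[OF f'(2)] iso_arr_base_change[OF fibre_square_sym[OF f'(2)] k_iso] hD(4)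
    by (simp_all add: homset_def Idn_simps)
  obtain h' k'' where h': "fprod D g k' = (h', k'')" "fibre_square D g k' h' k''"
    using cyclesD(1)[OF g(2)] k'(1) by (rule fprodE)
  have k'': "k'' \<in> homset D (Dom D k'') (Dom D g)" "iso_arr D k''"
    using fibre_squareD[OF h'(2)] iso_arr_base_change[OF fibre_square_sym[OF h'(2)] k'(2)]
    by (simp_all add: homset_def)
  have gk: "(g \<cdot> k'', map (fpull D k'') Ms) \<in> cycles D X"
    using cyclesI[OF Cmp_hom[OF k''(1) cyclesD(1)[OF g(2)]] map_fpull_fib[OF k''(1) cyclesD(4)[OF g(2)]]] .
  have "cyc D (g \<cdot> k'') (map (fpull D k'') Ms) = cyc D g Ms"
    using cyc_eqI[OF gk g(2) cycle_iso_pull[OF g(2) k'']] .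
  also have "\<dots> = cyc D (Idn D X) Ls"
    using cyc_eqI[OF I g(2,3)] by simp
  finally show ?thesis
    using len hD(2) by (simp add: om_prod_def om_theta_def g(1) k(1) f'(1) h'(1))
qed

end


section \<open>The value of a cobordism cycle in an oriented theory\<close>

lemma foldr_permute:
  assumes "mset xs = mset ys" "set xs \<subseteq> S" "a \<in> C"
    and closed: "\<And>x a. x \<in> S \<Longrightarrow> a \<in> C \<Longrightarrow> f x a \<in> C"
    and commute: "\<And>x y a. x \<in> S \<Longrightarrow> y \<in> S \<Longrightarrow> a \<in> C \<Longrightarrow> f x (f y a) = f y (f x a)"
  shows "foldr f xs a = foldr f ys a"
  using assms(1,2)
proof (induction xs arbitrary: ys)
  case (Cons x xs)
  then obtain us vs where ys: "ys = us @ x # vs"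
    by (metis list.set_intros(1) mset_eq_setD split_list)
  have S: "set (us @ vs) \<subseteq> S" "x \<in> S" and m: "mset xs = mset (us @ vs)"
    using Cons.prems mset_eq_setD[OF Cons.prems(1)] unfolding ys by auto
  have C: "foldr f zs a \<in> C" if "set zs \<subseteq> S" for zs
    using that \<open>a \<in> C\<close> by (induction zs) (simp_all add: closed)
  have "foldr f us (f x b) = f x (foldr f us b) \<and> foldr f us b \<in> C" if "b \<in> C" "set us \<subseteq> S" for us b
    using that(2) by (induction us) (use that(1) S(2) in \<open>simp_all add: closed commute\<close>)
  from this[of "foldr f vs a" us] have "foldr f ys a = f x (foldr f (us @ vs) a)"
    using S C[of vs] by (simp add: ys)
  then show ?case
    using Cons.IH[OF m] Cons.prems(2) by simp
qed simp

text \<open>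
  The fibre squares chosen in the operations on cycles have a confined arrow on one side;
  \<open>confined_indep\<close> opens them to the axioms of \<open>B\<close>.
\<close>
locale oriented_transformation = oriented_bivariant_theory D B
  for D :: "('o, 'm, 'l, 'e) bicat" (structure)
    and B :: "('o, 'm, 'l, 'b) oriented_bivariant" +
  fixes \<theta> :: "'m \<Rightarrow> 'b"
  assumes orientation: "nice_canonical_orientation D B \<theta>"
    and confined_indep:
      "\<lbrakk>fibre_square D f g f' g'; f \<in> Conf D \<or> g \<in> Conf D\<rbrakk> \<Longrightarrow> indep D f g f' g'"
begin

lemma theta_closed: "f \<in> Spec D \<Longrightarrow> \<theta> f \<in> carrier (grp B f)"
  and theta_Cmp: "\<lbrakk>f \<in> Spec D; g \<in> Spec D; Cod D f = Dom D g\<rbrakk> \<Longrightarrow> \<theta> (g \<cdot> f) = prd B f g (\<theta> f) (\<theta> g)"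
  and theta_Idn: "X \<in> Obj D \<Longrightarrow> \<theta> (Idn D X) = unt B X"
  and theta_pll: "\<lbrakk>f \<in> Spec D; indep D f g f' g'\<rbrakk> \<Longrightarrow> pll B f g f' g' (\<theta> f) = \<theta> f'"
  using orientation unfolding nice_canonical_orientation_def by auto

lemma prd_closed:
  "\<lbrakk>f \<in> homset D X Y; g \<in> homset D Y Z; \<alpha> \<in> carrier (grp B f); \<beta> \<in> carrier (grp B g)\<rbrakk>
    \<Longrightarrow> prd B f g \<alpha> \<beta> \<in> carrier (grp B (g \<cdot> f))"
  using hom_in_carrier[OF prd_hom_right] by metis

lemma psh_closed:
  "\<lbrakk>f \<in> homset D X Y; g \<in> homset D Y Z; f \<in> Conf D; \<alpha> \<in> carrier (grp B (g \<cdot> f))\<rbrakk>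
    \<Longrightarrow> psh B f g \<alpha> \<in> carrier (grp B g)"
  using hom_in_carrier[OF psh_hom] by metis

lemma pll_closed:
  "\<lbrakk>indep D f g f' g'; \<alpha> \<in> carrier (grp B f)\<rbrakk> \<Longrightarrow> pll B f g f' g' \<alpha> \<in> carrier (grp B f')"
  using hom_in_carrier[OF pll_hom] by metis

lemma ori_closed:
  "\<lbrakk>f \<in> homset D X Y; L \<in> fib D X; \<alpha> \<in> carrier (grp B f)\<rbrakk> \<Longrightarrow> ori B f L \<alpha> \<in> carrier (grp B f)"
  using hom_in_carrier[OF ori_hom] by metis

lemma foldr_ori_closed:
  assumes "f \<in> homset D X Y" "set Ls \<subseteq> fib D X" "\<alpha> \<in> carrier (grp B f)"
  shows "foldr (ori B f) Ls \<alpha> \<in> carrier (grp B f)"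
  using assms(2) by (induction Ls) (auto intro: ori_closed[OF assms(1)] assms(3))

lemma foldr_ori_mset:
  assumes "f \<in> homset D X Y" "set Ls \<subseteq> fib D X" "mset Ls = mset Ms" "\<alpha> \<in> carrier (grp B f)"
  shows "foldr (ori B f) Ls \<alpha> = foldr (ori B f) Ms \<alpha>"
  by (rule foldr_permute[OF assms(3,2,4)]) (auto intro: ori_closed ori_commute assms(1))

lemma foldr_ori_iso:
  assumes f: "f \<in> homset D X Y" and \<alpha>: "\<alpha> \<in> carrier (grp B f)"
    and "list_all2 (fib_iso D) Ls Ms" "set Ls \<subseteq> fib D X" "set Ms \<subseteq> fib D X"
  shows "foldr (ori B f) Ls \<alpha> = foldr (ori B f) Ms \<alpha>"
  using assms(3-5)
proof (induction rule: list_all2_induct)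
  case (Cons L Ls M Ms)
  then show ?case
    using ori_iso[OF f _ _ Cons.hyps(1)] foldr_ori_closed[OF f _ \<alpha>] by simp
qed simp

lemma foldr_ori_prd_left:
  assumes f: "f \<in> homset D X Y" and g: "g \<in> homset D Y Z" and Ls: "set Ls \<subseteq> fib D X"
    and \<alpha>: "\<alpha> \<in> carrier (grp B f)" and \<beta>: "\<beta> \<in> carrier (grp B g)"
  shows "foldr (ori B (g \<cdot> f)) Ls (prd B f g \<alpha> \<beta>) = prd B f g (foldr (ori B f) Ls \<alpha>) \<beta>"
  using Ls
proof (induction Ls)
  case (Cons L Ls)
  then show ?case
    using ori_prd_left[OF f g _ foldr_ori_closed[OF f _ \<alpha>] \<beta>] by simp
qed simp

lemma foldr_ori_prd_right:
  assumes f: "f \<in> homset D X Y" and g: "g \<in> homset D Y Z" and Ms: "set Ms \<subseteq> fib D Y"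
    and \<alpha>: "\<alpha> \<in> carrier (grp B f)" and \<beta>: "\<beta> \<in> carrier (grp B g)"
  shows "foldr (ori B (g \<cdot> f)) (map (fpull D f) Ms) (prd B f g \<alpha> \<beta>)
    = prd B f g \<alpha> (foldr (ori B g) Ms \<beta>)"
  using Ms
proof (induction Ms)
  case (Cons M Ms)
  then show ?case
    using ori_prd_right[OF f g _ \<alpha> foldr_ori_closed[OF g _ \<beta>]] by simp
qed simp

lemma foldr_ori_psh:
  assumes f: "f \<in> homset D X Y" "f \<in> Conf D" and g: "g \<in> homset D Y Z" and Ms: "set Ms \<subseteq> fib D Y"
    and \<alpha>: "\<alpha> \<in> carrier (grp B (g \<cdot> f))"
  shows "psh B f g (foldr (ori B (g \<cdot> f)) (map (fpull D f) Ms) \<alpha>) = foldr (ori B g) Ms (psh B f g \<alpha>)"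
  using Ms
proof (induction Ms)
  case (Cons M Ms)
  then have "foldr (ori B (g \<cdot> f)) (map (fpull D f) Ms) \<alpha> \<in> carrier (grp B (g \<cdot> f))"
    using map_fpull_fib[OF f(1), of Ms] by (intro foldr_ori_closed[OF Cmp_hom[OF f(1) g] _ \<alpha>]) simp
  then show ?case
    using Cons ori_psh[OF f(1) g f(2)] by simp
qed simp

lemma foldr_ori_pll:
  assumes sq: "indep D f g f' g'" and Ls: "set Ls \<subseteq> fib D (Dom D f)" and \<alpha>: "\<alpha> \<in> carrier (grp B f)"
  shows "pll B f g f' g' (foldr (ori B f) Ls \<alpha>)
    = foldr (ori B f') (map (fpull D g') Ls) (pll B f g f' g' \<alpha>)"
  using Ls
proof (induction Ls)
  case (Cons L Ls)
  have f: "f \<in> homset D (Dom D f) (Cod D f)"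
    using fibre_squareD(1)[OF indep_fibre_square[OF sq]] by (simp add: homset_def)
  show ?case
    using Cons ori_pll[OF sq _ foldr_ori_closed[OF f _ \<alpha>]] by simp
qed simp

text \<open>
  The projection formula for the square \<open>(u, u, id, id)\<close> gives \<open>\<theta>(u) \<bullet> u\<^sub>*\<beta> = \<beta>\<close> for all \<open>\<beta>\<close>. Taking
  \<open>\<beta> = \<theta>(w \<cdot> u) = \<theta>(u) \<bullet> \<theta>(w)\<close>, it remains to cancel \<open>\<theta>(u)\<close>, which is done by multiplying with
  \<open>\<theta>(u\<^sup>-\<^sup>1)\<close> from the left.
\<close>
lemma psh_theta_iso:
  assumes u: "u \<in> homset D X Y" "iso_arr D u" and w: "w \<in> homset D Y Z" "w \<in> Spec D"
  shows "psh B u w (\<theta> (w \<cdot> u)) = \<theta> w"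
proof -
  note uC = iso_arr_Conf_Spec[OF u]
  note uD = homsetD[OF u(1)] and wD = homsetD[OF w(1)]
  have wu: "\<theta> (w \<cdot> u) = prd B u w (\<theta> u) (\<theta> w)"
    using theta_Cmp[OF uC(2) w(2)] uD wD by simp
  have wu_in: "\<theta> (w \<cdot> u) \<in> carrier (grp B (w \<cdot> u))"
    using Spec_Cmp[OF uC(2) w(2)] uD wD by (simp add: theta_closed)
  note push_in = psh_closed[OF u(1) w(1) uC(1) wu_in]
  obtain v where v: "v \<in> homset D Y X" "u \<cdot> v = Idn D Y" "iso_arr D v"
    using u(2,1) by (rule iso_arrE)
  note vS = iso_arr_Conf_Spec(2)[OF v(1,3)]
  \<comment> \<open>\<open>\<theta>(v) \<bullet> \<theta>(u) = \<theta>(u \<cdot> v) = \<theta>(id) = 1\<close>\<close>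
  have cancel: "prd B v (w \<cdot> u) (\<theta> v) (prd B u w (\<theta> u) \<alpha>) = \<alpha>" if "\<alpha> \<in> carrier (grp B w)" for \<alpha>
  proof -
    have "prd B v (w \<cdot> u) (\<theta> v) (prd B u w (\<theta> u) \<alpha>) = prd B (u \<cdot> v) w (prd B v u (\<theta> v) (\<theta> u)) \<alpha>"
      using prd_assoc[OF v(1) u(1) w(1) theta_closed[OF vS] theta_closed[OF uC(2)] that] by simp
    also have "\<dots> = prd B (Idn D Y) w (unt B Y) \<alpha>"
      using theta_Cmp[OF vS uC(2)] homsetD[OF v(1)] uD v(2) theta_Idn[OF uD(5)] by simp
    finally show ?thesis
      using unt_prd[OF w(1) that] by simp
  qed
  have sq: "indep D u u (Idn D X) (Idn D X)"
    using fibre_square_iso_Idn[OF u] uC(1) by (intro confined_indep) simp_all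
  have "psh B (Idn D X) (w \<cdot> u) (prd B (Idn D X) (w \<cdot> u) (pll B u u (Idn D X) (Idn D X) (\<theta> u)) (\<theta> (w \<cdot> u)))
      = prd B u w (\<theta> u) (psh B u w (\<theta> (w \<cdot> u)))"
    using projection_formula[OF sq uC(1) _ theta_closed[OF uC(2)] wu_in] w(1) uD by simp
  moreover have "pll B u u (Idn D X) (Idn D X) (\<theta> u) = unt B X"
    using theta_pll[OF uC(2) sq] theta_Idn[OF uD(4)] by simp
  ultimately have eq: "prd B u w (\<theta> u) (\<theta> w) = prd B u w (\<theta> u) (psh B u w (\<theta> (w \<cdot> u)))"
    using unt_prd[OF Cmp_hom[OF u(1) w(1)] wu_in] psh_Idn[OF Cmp_hom[OF u(1) w(1)] wu_in] wu by simp
  show ?thesis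
    using cancel[OF theta_closed[OF w(2)]] unfolding eq cancel[OF push_in] .
qed

definition cycle_value :: "'m \<Rightarrow> 'm \<Rightarrow> 'l list \<Rightarrow> 'b"
  where "cycle_value f h Ls = psh B h f (foldr (ori B (f \<cdot> h)) Ls (\<theta> (f \<cdot> h)))"

lemma oriented_theta_closed:
  assumes f: "f \<in> homset D X Y" and z: "(h, Ls) \<in> om_cycles D f"
  shows "foldr (ori B (f \<cdot> h)) Ls (\<theta> (f \<cdot> h)) \<in> carrier (grp B (f \<cdot> h))"
  using om_cyclesD[OF f z] by (intro foldr_ori_closed[of _ "Dom D h"] theta_closed) simp_all

lemma cycle_value_closed:
  assumes f: "f \<in> homset D X Y" and z: "(h, Ls) \<in> om_cycles D f"
  shows "cycle_value f h Ls \<in> carrier (grp B f)"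
  unfolding cycle_value_def using om_cyclesD(1,4)[OF f z] f oriented_theta_closed[OF f z]
  by (intro psh_closed)

text \<open>
  For \<open>k \<cdot> u = h\<close>, split \<open>h\<^sub>*\<close> as \<open>k\<^sub>* \<circ> u\<^sub>*\<close>. Up to isomorphism and order the fiber-objects of the
  first cycle are pullbacks along \<open>u\<close> of those of the second, so the operators move past \<open>u\<^sub>*\<close>,
  and \<open>u\<^sub>*\<close> turns \<open>\<theta>(f \<cdot> h)\<close> into \<open>\<theta>(f \<cdot> k)\<close>.
\<close>
lemma cycle_value_iso:
  assumes f: "f \<in> homset D X Y" and z: "(h, Ls) \<in> om_cycles D f" and w: "(k, Ms) \<in> om_cycles D f"
    and iso: "cycle_iso D (h, Ls) (k, Ms)"
  shows "cycle_value f h Ls = cycle_value f k Ms"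
proof -
  note zD = om_cyclesD[OF f z] and wD = om_cyclesD[OF f w]
  obtain u \<sigma> where u: "u \<in> homset D (Dom D h) (Dom D k)" "iso_arr D u" "k \<cdot> u = h"
    and len: "length Ls = length Ms" and \<sigma>: "\<sigma> permutes {..<length Ls}"
    and fib: "\<forall>i < length Ls. fib_iso D (Ls ! i) (fpull D u (Ms ! \<sigma> i))"
    using iso by (rule cycle_isoE)
  \<comment> \<open>\<open>Ns\<close> pulled back along \<open>u\<close> matches \<open>Ls\<close> entry by entry; \<open>Ms\<close> differs from it by the order.\<close>
  define Ns where "Ns = permute_list \<sigma> Ms"
  have \<sigma>': "\<sigma> permutes {..<length Ms}"
    using \<sigma> len by simp
  have mset: "mset Ns = mset Ms" and set: "set Ns \<subseteq> fib D (Dom D k)"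
    using wD(3) set_permute_list[OF \<sigma>'] mset_permute_list[OF \<sigma>'] by (simp_all add: Ns_def)
  have all: "list_all2 (fib_iso D) Ls (map (fpull D u) Ns)"
    using fib len permute_list_nth[OF \<sigma>'] by (auto simp: list_all2_conv_all_nth Ns_def)
  note uC = iso_arr_Conf_Spec(1)[OF u(1,2)]
  have arr: "(f \<cdot> k) \<cdot> u = f \<cdot> h"
    using u(3) homsetD[OF u(1)] homsetD[OF f] homsetD[OF wD(1)] by (simp add: Cmp_assoc_Arr)
  have th: "\<theta> (f \<cdot> h) \<in> carrier (grp B (f \<cdot> h))"
    using zD(5) by (rule theta_closed)
  have eq: "foldr (ori B (f \<cdot> h)) Ls (\<theta> (f \<cdot> h)) = foldr (ori B (f \<cdot> h)) (map (fpull D u) Ns) (\<theta> (f \<cdot> h))"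
    using foldr_ori_iso[OF zD(2) th all zD(3) map_fpull_fib[OF u(1) set]] .
  have "psh B u (f \<cdot> k) (foldr (ori B (f \<cdot> h)) Ls (\<theta> (f \<cdot> h)))
      = foldr (ori B (f \<cdot> k)) Ns (psh B u (f \<cdot> k) (\<theta> (f \<cdot> h)))"
    unfolding eq using foldr_ori_psh[OF u(1) uC wD(2) set, of "\<theta> (f \<cdot> h)"] th unfolding arr by simp
  also have "psh B u (f \<cdot> k) (\<theta> (f \<cdot> h)) = \<theta> (f \<cdot> k)"
    using psh_theta_iso[OF u(1,2) wD(2,5)] unfolding arr .
  also have "foldr (ori B (f \<cdot> k)) Ns (\<theta> (f \<cdot> k)) = foldr (ori B (f \<cdot> k)) Ms (\<theta> (f \<cdot> k))"
    using foldr_ori_mset[OF wD(2) set mset theta_closed[OF wD(5)]] .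
  finally show ?thesis
    unfolding cycle_value_def
    using psh_Cmp[OF u(1) wD(1) f uC wD(4), of "foldr (ori B (f \<cdot> h)) Ls (\<theta> (f \<cdot> h))"] u(3)
      oriented_theta_closed[OF f z] by simp
qed

lemma cycle_value_Idn:
  assumes f: "f \<in> homset D X Y" "f \<in> Spec D" and Ls: "set Ls \<subseteq> fib D X"
  shows "cycle_value f (Idn D X) Ls = foldr (ori B f) Ls (\<theta> f)"
  unfolding cycle_value_def
  using psh_Idn[OF f(1) foldr_ori_closed[OF f(1) Ls theta_closed[OF f(2)]]] Cmp_Idn[OF f(1)] by simp

lemma cycle_value_psh:
  assumes f: "f \<in> homset D X Y" "f \<in> Conf D" and g: "g \<in> homset D Y Z"
    and z: "(h, Ls) \<in> om_cycles D (g \<cdot> f)"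
  shows "cycle_value g (f \<cdot> h) Ls = psh B f g (cycle_value (g \<cdot> f) h Ls)"
proof -
  note zD = om_cyclesD[OF Cmp_hom[OF f(1) g] z]
  have "(g \<cdot> f) \<cdot> h = g \<cdot> (f \<cdot> h)"
    using homsetD[OF f(1)] homsetD[OF g] homsetD[OF zD(1)] by (simp add: Cmp_assoc_Arr)
  then show ?thesis
    unfolding cycle_value_def
    using psh_Cmp[OF zD(1) f(1) g zD(4) f(2)] oriented_theta_closed[OF Cmp_hom[OF f(1) g] z] by simp
qed

text \<open>
  The new operator is applied first, whereas the compatibility of orientation and pushforward
  takes out the one applied last; commutativity of the operators bridges the two.
\<close>
lemma cycle_value_ori:
  assumes f: "f \<in> homset D X Y" and z: "(h, Ls) \<in> om_cycles D f" and L: "L \<in> fib D X"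
  shows "cycle_value f h (Ls @ [fpull D h L]) = ori B f L (cycle_value f h Ls)"
proof -
  note zD = om_cyclesD[OF f z]
  note hL = fpull_fib[OF zD(1) L]
  have "foldr (ori B (f \<cdot> h)) (Ls @ [fpull D h L]) (\<theta> (f \<cdot> h))
      = foldr (ori B (f \<cdot> h)) (fpull D h L # Ls) (\<theta> (f \<cdot> h))"
    using hL zD(3) by (intro foldr_ori_mset[OF zD(2) _ _ theta_closed[OF zD(5)]]) simp_all
  then show ?thesis
    unfolding cycle_value_def
    using ori_psh[OF zD(1) f zD(4) L oriented_theta_closed[OF f z]] by simp
qed

text \<open>
  The square of \<open>h\<close> is independent because \<open>h\<close> is confined. Base change moves \<open>g\<^sup>*\<close> inside \<open>h\<^sub>*\<close>, and
  the composite square carries \<open>\<theta>(f \<cdot> h)\<close> to \<open>\<theta>(f' \<cdot> h')\<close>.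
\<close>
lemma cycle_value_pll:
  assumes sq: "indep D f g f' g'" and z: "(h, Ls) \<in> om_cycles D f" and sq': "fibre_square D h g' h' g''"
  shows "cycle_value f' h' (map (fpull D g'') Ls) = pll B f g f' g' (cycle_value f h Ls)"
proof -
  note sqD = fibre_squareD[OF indep_fibre_square[OF sq]]
  have f: "f \<in> homset D (Dom D f) (Cod D f)"
    using sqD by (simp add: homset_def)
  note zD = om_cyclesD[OF f z]
  have ind: "indep D h g' h' g''"
    using sq' zD(4) by (intro confined_indep) simp_all
  note ind2 = indep_vertical[OF sq ind]
  have "pll B f g f' g' (cycle_value f h Ls)
      = psh B h' f' (pll B (f \<cdot> h) g (f' \<cdot> h') g'' (foldr (ori B (f \<cdot> h)) Ls (\<theta> (f \<cdot> h))))"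
    unfolding cycle_value_def using psh_pll[OF sq ind zD(4) oriented_theta_closed[OF f z]] by simp
  also have "pll B (f \<cdot> h) g (f' \<cdot> h') g'' (foldr (ori B (f \<cdot> h)) Ls (\<theta> (f \<cdot> h)))
      = foldr (ori B (f' \<cdot> h')) (map (fpull D g'') Ls) (\<theta> (f' \<cdot> h'))"
    using foldr_ori_pll[OF ind2 _ theta_closed[OF zD(5)]] theta_pll[OF zD(5) ind2] zD(3)
      homsetD(2)[OF zD(2)] by simp
  finally show ?thesis
    unfolding cycle_value_def by simp
qed

text \<open>
  Write the two values as \<open>h\<^sub>*A\<close> and \<open>k\<^sub>*C\<close>. Then
  \<open>h\<^sub>*A \<bullet> k\<^sub>*C = h\<^sub>*(A \<bullet> k\<^sub>*C) = h\<^sub>*k''\<^sub>*(k\<^sup>*A \<bullet> C)\<close> by the projection formula, and in \<open>k\<^sup>*A \<bullet> C\<close> all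
  operators come out in front of \<open>\<theta>(f' \<cdot> h') \<bullet> \<theta>(g \<cdot> k) = \<theta>(g \<cdot> k \<cdot> f' \<cdot> h')\<close>. The two ways around the
  composite square identify \<open>g \<cdot> k \<cdot> f' \<cdot> h'\<close> with \<open>(g \<cdot> f) \<cdot> (h \<cdot> k'')\<close>.
\<close>
lemma cycle_value_prd:
  assumes f: "f \<in> homset D X Y" and g: "g \<in> homset D Y Z"
    and z: "(h, Ls) \<in> om_cycles D f" and w: "(k, Ms) \<in> om_cycles D g"
    and sq: "fibre_square D f k f' k'" and sq': "fibre_square D h k' h' k''"
  shows "cycle_value (g \<cdot> f) (h \<cdot> k'') (map (fpull D k'') Ls @ map (fpull D (f' \<cdot> h')) Ms)
    = prd B f g (cycle_value f h Ls) (cycle_value g k Ms)"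
proof -
  note zD = om_cyclesD[OF f z] and wD = om_cyclesD[OF g w]
  note hD = homsetD[OF zD(1)] and kD = homsetD[OF wD(1)] and fD = homsetD[OF f] and gD = homsetD[OF g]
  note sqD = fibre_squareD[OF sq] and sqD' = fibre_squareD[OF sq']
  have ind1: "indep D f k f' k'" and ind2: "indep D h k' h' k''"
    using sq sq' zD(4) wD(4) by (simp_all add: confined_indep)
  note ind = indep_vertical[OF ind1 ind2]
  have k'': "k'' \<in> homset D (Dom D h') (Dom D h)" and fh': "f' \<cdot> h' \<in> homset D (Dom D h') (Dom D k)"
    using sqD sqD' by (simp_all add: homset_def Cmp_simps)
  have "k' \<in> Conf D"
    using Conf_base_change[OF wD(4) fibre_square_sym[OF sq]] .
  then have k''C: "k'' \<in> Conf D"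
    using Conf_base_change[OF _ fibre_square_sym[OF sq']] by simp
  have fh'S: "f' \<cdot> h' \<in> Spec D"
    using Spec_base_change[OF zD(5) indep_fibre_square[OF ind]] .
  have sqeq: "(f \<cdot> h) \<cdot> k'' = k \<cdot> (f' \<cdot> h')"
    using fibre_squareD(9)[OF indep_fibre_square[OF ind]] .
  have a1: "(g \<cdot> f) \<cdot> h = g \<cdot> (f \<cdot> h)"
    using hD fD gD by (simp add: Cmp_assoc_Arr)
  have "(g \<cdot> f) \<cdot> (h \<cdot> k'') = g \<cdot> ((f \<cdot> h) \<cdot> k'')"
    using hD fD gD sqD' by (simp add: Cmp_assoc_Arr Cmp_simps)
  then have a2: "(g \<cdot> f) \<cdot> (h \<cdot> k'') = (g \<cdot> k) \<cdot> (f' \<cdot> h')"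
    unfolding sqeq using kD gD homsetD[OF fh'] by (simp add: Cmp_assoc_Arr)
  define A where "A = foldr (ori B (f \<cdot> h)) Ls (\<theta> (f \<cdot> h))"
  define C where "C = foldr (ori B (g \<cdot> k)) Ms (\<theta> (g \<cdot> k))"
  define E where "E = foldr (ori B ((g \<cdot> k) \<cdot> (f' \<cdot> h')))
    (map (fpull D k'') Ls @ map (fpull D (f' \<cdot> h')) Ms) (\<theta> ((g \<cdot> k) \<cdot> (f' \<cdot> h')))"
  have A: "A \<in> carrier (grp B (f \<cdot> h))" and C: "C \<in> carrier (grp B (g \<cdot> k))"
    unfolding A_def C_def using oriented_theta_closed f g z w by blast+
  note th1 = theta_closed[OF fh'S] and th2 = theta_closed[OF wD(5)]
  have Ls': "set (map (fpull D k'') Ls) \<subseteq> fib D (Dom D h')"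
    using map_fpull_fib[OF k'' zD(3)] .
  have "pll B (f \<cdot> h) k (f' \<cdot> h') k'' A = foldr (ori B (f' \<cdot> h')) (map (fpull D k'') Ls) (\<theta> (f' \<cdot> h'))"
    unfolding A_def using foldr_ori_pll[OF ind _ theta_closed[OF zD(5)]] theta_pll[OF zD(5) ind] zD(3)
      homsetD(2)[OF zD(2)] by simp
  then have "prd B (f' \<cdot> h') (g \<cdot> k) (pll B (f \<cdot> h) k (f' \<cdot> h') k'' A) C
      = foldr (ori B ((g \<cdot> k) \<cdot> (f' \<cdot> h'))) (map (fpull D k'') Ls) (prd B (f' \<cdot> h') (g \<cdot> k) (\<theta> (f' \<cdot> h')) C)"
    using foldr_ori_prd_left[OF fh' wD(2) Ls' th1 C] by simp
  also have "prd B (f' \<cdot> h') (g \<cdot> k) (\<theta> (f' \<cdot> h')) C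
      = foldr (ori B ((g \<cdot> k) \<cdot> (f' \<cdot> h'))) (map (fpull D (f' \<cdot> h')) Ms)
          (prd B (f' \<cdot> h') (g \<cdot> k) (\<theta> (f' \<cdot> h')) (\<theta> (g \<cdot> k)))"
    unfolding C_def using foldr_ori_prd_right[OF fh' wD(2) wD(3) th1 th2] by simp
  also have "prd B (f' \<cdot> h') (g \<cdot> k) (\<theta> (f' \<cdot> h')) (\<theta> (g \<cdot> k)) = \<theta> ((g \<cdot> k) \<cdot> (f' \<cdot> h'))"
    using theta_Cmp[OF fh'S wD(5)] homsetD[OF fh'] homsetD[OF wD(2)] by simp
  finally have prdE: "prd B (f' \<cdot> h') (g \<cdot> k) (pll B (f \<cdot> h) k (f' \<cdot> h') k'' A) C = E"
    unfolding E_def by simp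
  have E: "E \<in> carrier (grp B ((g \<cdot> f) \<cdot> (h \<cdot> k'')))"
    unfolding a2 prdE[symmetric] by (rule prd_closed[OF fh' wD(2) pll_closed[OF ind A] C])
  have "prd B f g (psh B h f A) (psh B k g C) = psh B h (g \<cdot> f) (prd B (f \<cdot> h) g A (psh B k g C))"
    using psh_prd[OF zD(1) f g zD(4) A psh_closed[OF wD(1) g wD(4) C]] by simp
  also have "prd B (f \<cdot> h) g A (psh B k g C) = psh B k'' (g \<cdot> (f \<cdot> h)) E"
    using projection_formula[OF ind wD(4) _ A C, of Z] g homsetD(3)[OF zD(2)] prdE by simp
  also have "psh B h (g \<cdot> f) (psh B k'' (g \<cdot> (f \<cdot> h)) E) = psh B (h \<cdot> k'') (g \<cdot> f) E"
    using psh_Cmp[OF k'' zD(1) Cmp_hom[OF f g] k''C zD(4) E] a1 by simp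
  finally show ?thesis
    unfolding cycle_value_def A_def C_def E_def a2 by simp
qed

end


section \<open>The transformation of bivariant theories\<close>

lemma free_Abelian_group_hom_eqI:
  assumes G: "group G" and p: "p \<in> hom (free_Abelian_group S) G" and q: "q \<in> hom (free_Abelian_group S) G"
    and eq: "\<And>c. c \<in> S \<Longrightarrow> p (frag_of c) = q (frag_of c)"
    and \<alpha>: "Poly_Mapping.keys \<alpha> \<subseteq> S"
  shows "p \<alpha> = q \<alpha>"
proof -
  interpret p: group_hom "free_Abelian_group S" G p
    by (intro group_hom.intro group_hom_axioms.intro) (simp_all add: G p)
  interpret q: group_hom "free_Abelian_group S" G q
    by (intro group_hom.intro group_hom_axioms.intro) (simp_all add: G q)
  show ?thesis
  proof (rule free_Abelian_group_induct[OF \<alpha>])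
    show "p 0 = q 0"
      using p.hom_one q.hom_one by simp
  next
    fix x y
    assume xy: "Poly_Mapping.keys x \<subseteq> S" "Poly_Mapping.keys y \<subseteq> S" "p x = q x" "p y = q y"
    have "x - y = x \<otimes>\<^bsub>free_Abelian_group S\<^esub> inv\<^bsub>free_Abelian_group S\<^esub> y"
      using xy(2) by simp
    moreover have "inv\<^bsub>free_Abelian_group S\<^esub> y \<in> carrier (free_Abelian_group S)"
      using xy(2) by (simp add: keys_minus)
    ultimately show "p (x - y) = q (x - y)"
      using xy p.hom_mult[of x] q.hom_mult[of x] p.hom_inv[of y] q.hom_inv[of y]
      by (simp del: mult_free_Abelian_group inv_free_Abelian_group)
  qed (rule eq)
qed

lemma frag_extend_hom:
  assumes "\<And>c. c \<in> S \<Longrightarrow> Poly_Mapping.keys (f c) \<subseteq> T"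
  shows "frag_extend f \<in> hom (free_Abelian_group S) (free_Abelian_group T)"
proof (rule homI)
  fix x assume "x \<in> carrier (free_Abelian_group S)"
  then show "frag_extend f x \<in> carrier (free_Abelian_group T)"
    using keys_frag_extend[of f x] assms by fastforce
qed (simp add: frag_extend_add)

context oriented_transformation
begin

text \<open>
  The homomorphism with these values on generators exists by the universal property of the free
  abelian group; its values outside that group are arbitrary.
\<close>
definition om_value :: "'m \<Rightarrow> (('m, 'l) cycle set \<Rightarrow>\<^sub>0 int) \<Rightarrow> 'b"
  where "om_value f = (SOME p. p \<in> hom (free_Abelian_group (om_generators D f)) (grp B f) \<and>
    (\<forall>c \<in> om_generators D f. p (frag_of c) = (case rep c of (h, Ls) \<Rightarrow> cycle_value f h Ls)))"

lemma group_grp: "f \<in> homset D X Y \<Longrightarrow> group (grp B f)"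
  using grp_comm_group homsetD(1) comm_group.axioms(2) by blast

lemma om_value_spec:
  assumes f: "f \<in> homset D X Y"
  shows "om_value f \<in> hom (free_Abelian_group (om_generators D f)) (grp B f) \<and>
    (\<forall>c \<in> om_generators D f. om_value f (frag_of c) = (case rep c of (h, Ls) \<Rightarrow> cycle_value f h Ls))"
proof -
  have "(\<lambda>c. case rep c of (h, Ls) \<Rightarrow> cycle_value f h Ls) ` om_generators D f \<subseteq> carrier (grp B f)"
    using om_generatorsE[OF f] cycle_value_closed[OF f] by (auto split: prod.split) metis
  then have "\<exists>p. p \<in> hom (free_Abelian_group (om_generators D f)) (grp B f) \<and>
    (\<forall>c \<in> om_generators D f. p (frag_of c) = (case rep c of (h, Ls) \<Rightarrow> cycle_value f h Ls))"
    by (rule comm_group.free_Abelian_group_universal[OF grp_comm_group[OF homsetD(1)[OF f]]]) blast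
  then show ?thesis
    unfolding om_value_def by (rule someI_ex)
qed

lemma om_value_hom: "f \<in> homset D X Y \<Longrightarrow> om_value f \<in> hom (free_Abelian_group (om_generators D f)) (grp B f)"
  using om_value_spec by blast

lemma om_value_closed:
  "f \<in> homset D X Y \<Longrightarrow> Poly_Mapping.keys \<alpha> \<subseteq> om_generators D f \<Longrightarrow> om_value f \<alpha> \<in> carrier (grp B f)"
  using hom_in_carrier[OF om_value_hom] by simp

lemma om_value_rep:
  assumes f: "f \<in> homset D X Y" and c: "c \<in> om_generators D f" "rep c = (h, Ls)"
  shows "om_value f (frag_of c) = cycle_value f h Ls"
  using om_value_spec[OF f] c by simp

lemma om_value_cyc:
  assumes f: "f \<in> homset D X Y" and z: "(h, Ls) \<in> om_cycles D f"
  shows "om_value f (frag_of (cyc D h Ls)) = cycle_value f h Ls"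
proof -
  note zD = om_cyclesD[OF f z]
  obtain k Ms where k: "rep (cyc D h Ls) = (k, Ms)" "(k, Ms) \<in> om_cycles D f" "cyc D h Ls = cyc D k Ms"
    by (rule om_generatorsE[OF f om_generatorsI[OF z]])
  have "cycle_iso D (h, Ls) (k, Ms)"
    using rep_cycE[OF zD(6)] k(1) by (metis prod.inject)
  then show ?thesis
    using om_value_rep[OF f om_generatorsI[OF z] k(1)] cycle_value_iso[OF f z k(2)] by simp
qed

lemma om_value_theta:
  assumes f: "f \<in> homset D X Y" "f \<in> Spec D"
  shows "om_theta D f \<in> carrier (free_Abelian_group (om_generators D f))"
    "om_value f (om_theta D f) = \<theta> f"
proof -
  have z: "(Idn D X, []) \<in> om_cycles D f"
    using om_cycles_Idn[OF f] by simp
  then show "om_theta D f \<in> carrier (free_Abelian_group (om_generators D f))"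
    using om_generatorsI[OF z] homsetD(2)[OF f(1)] by (simp add: om_theta_def)
  show "om_value f (om_theta D f) = \<theta> f"
    using om_value_cyc[OF f(1) z] cycle_value_Idn[OF f, of "[]"] homsetD(2)[OF f(1)]
    by (simp add: om_theta_def)
qed

lemma om_push_hom:
  assumes f: "f \<in> homset D X Y" "f \<in> Conf D" and g: "g \<in> homset D Y Z"
  shows "om_push D f g \<in> hom (free_Abelian_group (om_generators D (g \<cdot> f))) (free_Abelian_group (om_generators D g))"
  unfolding om_push_def
proof (rule frag_extend_hom)
  fix c assume "c \<in> om_generators D (g \<cdot> f)"
  then obtain h Ls where "rep c = (h, Ls)" "(h, Ls) \<in> om_cycles D (g \<cdot> f)"
    by (rule om_generatorsE[OF Cmp_hom[OF f(1) g]])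
  then show "Poly_Mapping.keys (case rep c of (h, Ls) \<Rightarrow> frag_of (cyc D (f \<cdot> h) Ls)) \<subseteq> om_generators D g"
    using om_generatorsI[OF om_push_cycles[OF f g]] by simp
qed

lemma om_value_push:
  assumes f: "f \<in> homset D X Y" "f \<in> Conf D" and g: "g \<in> homset D Y Z"
    and \<alpha>: "Poly_Mapping.keys \<alpha> \<subseteq> om_generators D (g \<cdot> f)"
  shows "om_value g (om_push D f g \<alpha>) = psh B f g (om_value (g \<cdot> f) \<alpha>)"
proof -
  note gf = Cmp_hom[OF f(1) g]
  have "(om_value g \<circ> om_push D f g) \<alpha> = (psh B f g \<circ> om_value (g \<cdot> f)) \<alpha>"
  proof (rule free_Abelian_group_hom_eqI[OF group_grp[OF g] _ _ _ \<alpha>])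
    show "om_value g \<circ> om_push D f g \<in> hom (free_Abelian_group (om_generators D (g \<cdot> f))) (grp B g)"
      by (rule hom_compose[OF om_push_hom[OF f g] om_value_hom[OF g]])
    show "psh B f g \<circ> om_value (g \<cdot> f) \<in> hom (free_Abelian_group (om_generators D (g \<cdot> f))) (grp B g)"
      by (rule hom_compose[OF om_value_hom[OF gf] psh_hom[OF f(1) g f(2)]])
    fix c assume c: "c \<in> om_generators D (g \<cdot> f)"
    then obtain h Ls where h: "rep c = (h, Ls)" "(h, Ls) \<in> om_cycles D (g \<cdot> f)"
      by (rule om_generatorsE[OF gf])
    then show "(om_value g \<circ> om_push D f g) (frag_of c) = (psh B f g \<circ> om_value (g \<cdot> f)) (frag_of c)"
      using om_value_cyc[OF g om_push_cycles[OF f g h(2)]] om_value_rep[OF gf c h(1)]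
        cycle_value_psh[OF f g h(2)] by (simp add: om_push_def)
  qed
  then show ?thesis by simp
qed

lemma om_ori_hom:
  assumes f: "f \<in> homset D X Y" and L: "L \<in> fib D X"
  shows "om_ori D f L \<in> hom (free_Abelian_group (om_generators D f)) (free_Abelian_group (om_generators D f))"
  unfolding om_ori_def
proof (rule frag_extend_hom)
  fix c assume "c \<in> om_generators D f"
  then obtain h Ls where "rep c = (h, Ls)" "(h, Ls) \<in> om_cycles D f"
    by (rule om_generatorsE[OF f])
  then show "Poly_Mapping.keys (case rep c of (h, Ls) \<Rightarrow> frag_of (cyc D h (Ls @ [fpull D h L]))) \<subseteq> om_generators D f"
    using om_generatorsI[OF om_ori_cycles[OF f _ L]] by simp
qed

lemma om_value_ori:
  assumes f: "f \<in> homset D X Y" and L: "L \<in> fib D X"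
    and \<alpha>: "Poly_Mapping.keys \<alpha> \<subseteq> om_generators D f"
  shows "om_value f (om_ori D f L \<alpha>) = ori B f L (om_value f \<alpha>)"
proof -
  have "(om_value f \<circ> om_ori D f L) \<alpha> = (ori B f L \<circ> om_value f) \<alpha>"
  proof (rule free_Abelian_group_hom_eqI[OF group_grp[OF f] _ _ _ \<alpha>])
    show "om_value f \<circ> om_ori D f L \<in> hom (free_Abelian_group (om_generators D f)) (grp B f)"
      by (rule hom_compose[OF om_ori_hom[OF f L] om_value_hom[OF f]])
    show "ori B f L \<circ> om_value f \<in> hom (free_Abelian_group (om_generators D f)) (grp B f)"
      by (rule hom_compose[OF om_value_hom[OF f] ori_hom[OF f L]])
    fix c assume c: "c \<in> om_generators D f"
    then obtain h Ls where h: "rep c = (h, Ls)" "(h, Ls) \<in> om_cycles D f"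
      by (rule om_generatorsE[OF f])
    then show "(om_value f \<circ> om_ori D f L) (frag_of c) = (ori B f L \<circ> om_value f) (frag_of c)"
      using om_value_cyc[OF f om_ori_cycles[OF f h(2) L]] om_value_rep[OF f c h(1)]
        cycle_value_ori[OF f h(2) L] by (simp add: om_ori_def)
  qed
  then show ?thesis by simp
qed

text \<open>
  Serves both to see that \<open>om_pull\<close> stays inside the group of \<open>f'\<close> and to compare values.
\<close>
lemma om_pull_generator:
  assumes sq: "indep D f g f' g'" and f: "f \<in> homset D X Y" and c: "c \<in> om_generators D f"
  obtains z where "om_pull D f g f' g' (frag_of c) = frag_of z" "z \<in> om_generators D f'"
    "om_value f' (frag_of z) = pll B f g f' g' (om_value f (frag_of c))"
proof -
  note sqD = fibre_squareD[OF indep_fibre_square[OF sq]] and fD = homsetD[OF f]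
  have f': "f' \<in> homset D (Dom D f') (Cod D f')" and g': "g' \<in> homset D (Dom D g') X"
    using sqD fD by (simp_all add: homset_def)
  obtain h Ls where h: "rep c = (h, Ls)" "(h, Ls) \<in> om_cycles D f"
    using c by (rule om_generatorsE[OF f])
  note hD = om_cyclesD[OF f h(2)]
  obtain h' g'' where h': "fprod D h g' = (h', g'')" "fibre_square D h g' h' g''"
    using hD(1) g' by (rule fprodE)
  have "indep D h g' h' g''"
    using confined_indep[OF h'(2)] hD(4) by simp
  note z = om_pull_cycles[OF sq h(2) h'(2) indep_fibre_square[OF indep_vertical[OF sq this]]]
  show thesis
  proof (rule that[OF _ om_generatorsI[OF z]])
    show "om_pull D f g f' g' (frag_of c) = frag_of (cyc D h' (map (fpull D g'') Ls))"
      by (simp add: om_pull_def h(1) h'(1))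
    show "om_value f' (frag_of (cyc D h' (map (fpull D g'') Ls))) = pll B f g f' g' (om_value f (frag_of c))"
      using om_value_cyc[OF f' z] om_value_rep[OF f c h(1)] cycle_value_pll[OF sq h(2) h'(2)] by simp
  qed
qed

lemma om_pull_hom:
  assumes sq: "indep D f g f' g'"
  shows "om_pull D f g f' g' \<in> hom (free_Abelian_group (om_generators D f)) (free_Abelian_group (om_generators D f'))"
  unfolding om_pull_def
proof (rule frag_extend_hom)
  have f: "f \<in> homset D (Dom D f) (Cod D f)"
    using fibre_squareD[OF indep_fibre_square[OF sq]] by (simp add: homset_def)
  fix c assume c: "c \<in> om_generators D f"
  obtain z where "om_pull D f g f' g' (frag_of c) = frag_of z" "z \<in> om_generators D f'"
    by (rule om_pull_generator[OF sq f c])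
  then show "Poly_Mapping.keys (case rep c of (h, Ls) \<Rightarrow>
      case fprod D h g' of (h', g'') \<Rightarrow> frag_of (cyc D h' (map (fpull D g'') Ls))) \<subseteq> om_generators D f'"
    by (simp add: om_pull_def)
qed

lemma om_value_pull:
  assumes sq: "indep D f g f' g'" and \<alpha>: "Poly_Mapping.keys \<alpha> \<subseteq> om_generators D f"
  shows "om_value f' (om_pull D f g f' g' \<alpha>) = pll B f g f' g' (om_value f \<alpha>)"
proof -
  have f: "f \<in> homset D (Dom D f) (Cod D f)" and f': "f' \<in> homset D (Dom D f') (Cod D f')"
    using fibre_squareD[OF indep_fibre_square[OF sq]] by (simp_all add: homset_def)
  have "(om_value f' \<circ> om_pull D f g f' g') \<alpha> = (pll B f g f' g' \<circ> om_value f) \<alpha>"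
  proof (rule free_Abelian_group_hom_eqI[OF group_grp[OF f'] _ _ _ \<alpha>])
    show "om_value f' \<circ> om_pull D f g f' g' \<in> hom (free_Abelian_group (om_generators D f)) (grp B f')"
      by (rule hom_compose[OF om_pull_hom[OF sq] om_value_hom[OF f']])
    show "pll B f g f' g' \<circ> om_value f \<in> hom (free_Abelian_group (om_generators D f)) (grp B f')"
      by (rule hom_compose[OF om_value_hom[OF f] pll_hom[OF sq]])
    fix c assume c: "c \<in> om_generators D f"
    obtain z where "om_pull D f g f' g' (frag_of c) = frag_of z" "z \<in> om_generators D f'"
      "om_value f' (frag_of z) = pll B f g f' g' (om_value f (frag_of c))"
      by (rule om_pull_generator[OF sq f c])
    then show "(om_value f' \<circ> om_pull D f g f' g') (frag_of c) = (pll B f g f' g' \<circ> om_value f) (frag_of c)"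
      by simp
  qed
  then show ?thesis by simp
qed

lemma om_prod_generator:
  assumes f: "f \<in> homset D X Y" and g: "g \<in> homset D Y Z"
    and a: "a \<in> om_generators D f" and b: "b \<in> om_generators D g"
  obtains z where "om_prod D f g (frag_of a) (frag_of b) = frag_of z" "z \<in> om_generators D (g \<cdot> f)"
    "om_value (g \<cdot> f) (frag_of z) = prd B f g (om_value f (frag_of a)) (om_value g (frag_of b))"
proof -
  obtain h Ls where h: "rep a = (h, Ls)" "(h, Ls) \<in> om_cycles D f"
    using a by (rule om_generatorsE[OF f])
  obtain k Ms where k: "rep b = (k, Ms)" "(k, Ms) \<in> om_cycles D g"
    using b by (rule om_generatorsE[OF g])
  note hD = om_cyclesD[OF f h(2)] and kD = om_cyclesD[OF g k(2)]
  obtain f' k' where f': "fprod D f k = (f', k')" "fibre_square D f k f' k'"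
    using f kD(1) by (rule fprodE)
  have k': "k' \<in> homset D (Dom D k') X"
    using fibre_squareD[OF f'(2)] homsetD[OF f] by (simp add: homset_def)
  obtain h' k'' where h': "fprod D h k' = (h', k'')" "fibre_square D h k' h' k''"
    using hD(1) k' by (rule fprodE)
  have "indep D f k f' k'" "indep D h k' h' k''"
    using confined_indep[OF f'(2)] confined_indep[OF h'(2)] hD(4) kD(4) by simp_all
  note z = om_prod_cycles[OF f g h(2) k(2) f'(2) h'(2) indep_fibre_square[OF indep_vertical[OF this]]]
  show thesis
  proof (rule that[OF _ om_generatorsI[OF z]])
    show "om_prod D f g (frag_of a) (frag_of b)
        = frag_of (cyc D (h \<cdot> k'') (map (fpull D k'') Ls @ map (fpull D (f' \<cdot> h')) Ms))"
      by (simp add: om_prod_def h(1) k(1) f'(1) h'(1))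
    show "om_value (g \<cdot> f) (frag_of (cyc D (h \<cdot> k'') (map (fpull D k'') Ls @ map (fpull D (f' \<cdot> h')) Ms)))
        = prd B f g (om_value f (frag_of a)) (om_value g (frag_of b))"
      using om_value_cyc[OF Cmp_hom[OF f g] z] om_value_rep[OF f a h(1)] om_value_rep[OF g b k(1)]
        cycle_value_prd[OF f g h(2) k(2) f'(2) h'(2)] by simp
  qed
qed

lemma om_prod_hom_right:
  assumes f: "f \<in> homset D X Y" and g: "g \<in> homset D Y Z" and a: "a \<in> om_generators D f"
  shows "om_prod D f g (frag_of a)
    \<in> hom (free_Abelian_group (om_generators D g)) (free_Abelian_group (om_generators D (g \<cdot> f)))"
proof -
  define F where "F b = om_prod D f g (frag_of a) (frag_of b)" for b
  have eq: "om_prod D f g (frag_of a) = frag_extend F"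
    by (rule ext) (simp add: F_def[abs_def] om_prod_def)
  show ?thesis
    unfolding eq
  proof (rule frag_extend_hom)
    fix b assume "b \<in> om_generators D g"
    then obtain z where "F b = frag_of z" "z \<in> om_generators D (g \<cdot> f)"
      unfolding F_def by (rule om_prod_generator[OF f g a])
    then show "Poly_Mapping.keys (F b) \<subseteq> om_generators D (g \<cdot> f)" by simp
  qed
qed

lemma om_prod_hom_left:
  assumes f: "f \<in> homset D X Y" and g: "g \<in> homset D Y Z"
    and \<beta>: "Poly_Mapping.keys \<beta> \<subseteq> om_generators D g"
  shows "(\<lambda>\<alpha>. om_prod D f g \<alpha> \<beta>)
    \<in> hom (free_Abelian_group (om_generators D f)) (free_Abelian_group (om_generators D (g \<cdot> f)))"
proof -
  define F where "F a = om_prod D f g (frag_of a) \<beta>" for a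
  have eq: "(\<lambda>\<alpha>. om_prod D f g \<alpha> \<beta>) = frag_extend F"
    by (rule ext) (simp add: F_def[abs_def] om_prod_def)
  show ?thesis
    unfolding eq
  proof (rule frag_extend_hom)
    fix a assume a: "a \<in> om_generators D f"
    show "Poly_Mapping.keys (F a) \<subseteq> om_generators D (g \<cdot> f)"
      using hom_in_carrier[OF om_prod_hom_right[OF f g a], of \<beta>] \<beta> by (simp add: F_def)
  qed
qed

text \<open>
  Both sides are biadditive: first \<open>\<beta>\<close> varies with \<open>\<alpha>\<close> a generator, then \<open>\<alpha>\<close> varies.
\<close>
lemma om_value_prod:
  assumes f: "f \<in> homset D X Y" and g: "g \<in> homset D Y Z"
    and \<alpha>: "Poly_Mapping.keys \<alpha> \<subseteq> om_generators D f" and \<beta>: "Poly_Mapping.keys \<beta> \<subseteq> om_generators D g"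
  shows "om_value (g \<cdot> f) (om_prod D f g \<alpha> \<beta>) = prd B f g (om_value f \<alpha>) (om_value g \<beta>)"
proof -
  note gf = Cmp_hom[OF f g]
  have gen: "om_value (g \<cdot> f) (om_prod D f g (frag_of a) \<beta>) = prd B f g (om_value f (frag_of a)) (om_value g \<beta>)"
    if a: "a \<in> om_generators D f" for a
  proof -
    have va: "om_value f (frag_of a) \<in> carrier (grp B f)"
      using om_value_closed[OF f, of "frag_of a"] a by simp
    have "(om_value (g \<cdot> f) \<circ> om_prod D f g (frag_of a)) \<beta>
        = (prd B f g (om_value f (frag_of a)) \<circ> om_value g) \<beta>"
    proof (rule free_Abelian_group_hom_eqI[OF group_grp[OF gf] _ _ _ \<beta>])
      show "om_value (g \<cdot> f) \<circ> om_prod D f g (frag_of a)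
          \<in> hom (free_Abelian_group (om_generators D g)) (grp B (g \<cdot> f))"
        by (rule hom_compose[OF om_prod_hom_right[OF f g a] om_value_hom[OF gf]])
      show "prd B f g (om_value f (frag_of a)) \<circ> om_value g
          \<in> hom (free_Abelian_group (om_generators D g)) (grp B (g \<cdot> f))"
        by (rule hom_compose[OF om_value_hom[OF g] prd_hom_right[OF f g va]])
      fix b assume b: "b \<in> om_generators D g"
      obtain z where "om_prod D f g (frag_of a) (frag_of b) = frag_of z"
        "om_value (g \<cdot> f) (frag_of z) = prd B f g (om_value f (frag_of a)) (om_value g (frag_of b))"
        by (rule om_prod_generator[OF f g a b])
      then show "(om_value (g \<cdot> f) \<circ> om_prod D f g (frag_of a)) (frag_of b)
          = (prd B f g (om_value f (frag_of a)) \<circ> om_value g) (frag_of b)"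
        by simp
    qed
    then show ?thesis by simp
  qed
  have "(om_value (g \<cdot> f) \<circ> (\<lambda>\<alpha>. om_prod D f g \<alpha> \<beta>)) \<alpha>
      = ((\<lambda>\<alpha>. prd B f g \<alpha> (om_value g \<beta>)) \<circ> om_value f) \<alpha>"
  proof (rule free_Abelian_group_hom_eqI[OF group_grp[OF gf] _ _ _ \<alpha>])
    show "om_value (g \<cdot> f) \<circ> (\<lambda>\<alpha>. om_prod D f g \<alpha> \<beta>)
        \<in> hom (free_Abelian_group (om_generators D f)) (grp B (g \<cdot> f))"
      by (rule hom_compose[OF om_prod_hom_left[OF f g \<beta>] om_value_hom[OF gf]])
    show "(\<lambda>\<alpha>. prd B f g \<alpha> (om_value g \<beta>)) \<circ> om_value f
        \<in> hom (free_Abelian_group (om_generators D f)) (grp B (g \<cdot> f))"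
      by (rule hom_compose[OF om_value_hom[OF f] prd_hom_left[OF f g om_value_closed[OF g \<beta>]]])
  qed (simp add: gen)
  then show ?thesis by simp
qed

end


section \<open>Exterior products and the two natural transformations\<close>

lemma OM_simps:
  "grp (OM D) = (\<lambda>f. free_Abelian_group (om_generators D f))"
  "prd (OM D) = om_prod D" "psh (OM D) = om_push D" "pll (OM D) = om_pull D"
  "unt (OM D) = (\<lambda>X. frag_of (cyc D (Idn D X) []))" "ori (OM D) = om_ori D"
  by (simp_all add: OM_def)

context oriented_transformation
begin

lemma om_pull_closed:
  assumes "indep D f g f' g'" "Poly_Mapping.keys \<alpha> \<subseteq> om_generators D f"
  shows "Poly_Mapping.keys (om_pull D f g f' g' \<alpha>) \<subseteq> om_generators D f'"
  using hom_in_carrier[OF om_pull_hom[OF assms(1)], of \<alpha>] assms(2) by simp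

lemma om_prod_closed:
  assumes "f \<in> homset D X Y" "g \<in> homset D Y Z"
    and "Poly_Mapping.keys \<alpha> \<subseteq> om_generators D f" "Poly_Mapping.keys \<beta> \<subseteq> om_generators D g"
  shows "Poly_Mapping.keys (om_prod D f g \<alpha> \<beta>) \<subseteq> om_generators D (g \<cdot> f)"
  using hom_in_carrier[OF om_prod_hom_left[OF assms(1,2,4)], of \<alpha>] assms(3) by simp

lemma bm_nat_trans_om_value:
  assumes ext: "exterior_squares_independent D"
  shows "bm_nat_trans D (OM D) (om_theta D) B \<theta> (\<lambda>X. om_value (trm D X))"
  unfolding bm_nat_trans_def bm_grp_def bm_push_def bm_gysin_def bm_ext_def OM_simps
proof (intro conjI ballI allI impI)
  fix X assume "X \<in> Obj D"
  then show "om_value (trm D X) \<in> hom (free_Abelian_group (om_generators D (trm D X))) (grp B (trm D X))"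
    using om_value_hom[OF trm_hom] by blast
next
  fix f and \<alpha> :: "('m, 'l) cycle set \<Rightarrow>\<^sub>0 int"
  assume fC: "f \<in> Conf D" and \<alpha>0: "\<alpha> \<in> carrier (free_Abelian_group (om_generators D (trm D (Dom D f))))"
  note \<alpha> = \<alpha>0[unfolded carrier_free_Abelian_group_iff]
  have f: "f \<in> homset D (Dom D f) (Cod D f)"
    using fC Conf_Arr by (auto simp: homset_def)
  show "om_value (trm D (Cod D f)) (om_push D f (trm D (Cod D f)) \<alpha>)
      = psh B f (trm D (Cod D f)) (om_value (trm D (Dom D f)) \<alpha>)"
    using om_value_push[OF f fC trm_hom[OF homsetD(5)[OF f]]] \<alpha> unfolding trm_Cmp[OF f] by blast
next
  fix f and \<alpha> :: "('m, 'l) cycle set \<Rightarrow>\<^sub>0 int"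
  assume fS: "f \<in> Spec D" and \<alpha>0: "\<alpha> \<in> carrier (free_Abelian_group (om_generators D (trm D (Cod D f))))"
  note \<alpha> = \<alpha>0[unfolded carrier_free_Abelian_group_iff]
  have f: "f \<in> homset D (Dom D f) (Cod D f)"
    using fS Spec_Arr by (auto simp: homset_def)
  have "Poly_Mapping.keys (om_theta D f) \<subseteq> om_generators D f"
    using om_value_theta(1)[OF f fS] by simp
  from om_value_prod[OF f trm_hom[OF homsetD(5)[OF f]] this \<alpha>]
  show "om_value (trm D (Dom D f)) (om_prod D f (trm D (Cod D f)) (om_theta D f) \<alpha>)
      = prd B f (trm D (Cod D f)) (\<theta> f) (om_value (trm D (Cod D f)) \<alpha>)"
    unfolding trm_Cmp[OF f] om_value_theta(2)[OF f fS] .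
next
  fix p q and \<alpha> \<beta> :: "('m, 'l) cycle set \<Rightarrow>\<^sub>0 int"
  assume pq: "is_product D p q"
    and \<alpha>0: "\<alpha> \<in> carrier (free_Abelian_group (om_generators D (trm D (Cod D p))))"
    and \<beta>0: "\<beta> \<in> carrier (free_Abelian_group (om_generators D (trm D (Cod D q))))"
  note \<alpha> = \<alpha>0[unfolded carrier_free_Abelian_group_iff] and \<beta> = \<beta>0[unfolded carrier_free_Abelian_group_iff]
  note ind = product_square_indep[OF ext pq]
  have q: "q \<in> homset D (Dom D p) (Cod D q)"
    using fibre_squareD[OF pq[unfolded is_product_def]] by (simp add: homset_def)
  from om_value_prod[OF q trm_hom[OF homsetD(5)[OF q]] om_pull_closed[OF ind \<alpha>] \<beta>]
  show "om_value (trm D (Dom D p)) (om_prod D q (trm D (Cod D q))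
        (om_pull D (trm D (Cod D p)) (trm D (Cod D q)) q p \<alpha>) \<beta>)
      = prd B q (trm D (Cod D q)) (pll B (trm D (Cod D p)) (trm D (Cod D q)) q p
          (om_value (trm D (Cod D p)) \<alpha>)) (om_value (trm D (Cod D q)) \<beta>)"
    unfolding trm_Cmp[OF q] om_value_pull[OF ind \<alpha>] .
next
  fix X L and \<alpha> :: "('m, 'l) cycle set \<Rightarrow>\<^sub>0 int"
  assume "X \<in> Obj D" "L \<in> fib D X" "\<alpha> \<in> carrier (free_Abelian_group (om_generators D (trm D X)))"
  then show "om_value (trm D X) (om_ori D (trm D X) L \<alpha>) = ori B (trm D X) L (om_value (trm D X) \<alpha>)"
    using om_value_ori[OF trm_hom] by simp
qed

lemma om_value_Idn_cycle:
  assumes f: "f \<in> homset D X Y" "f \<in> Spec D" and Ls: "set Ls \<subseteq> fib D X"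
  shows "om_value f (frag_of (cyc D (Idn D X) Ls)) = foldr (ori B f) Ls (\<theta> f)"
  using om_value_cyc[OF f(1) om_cycles_Idn[OF f Ls]] cycle_value_Idn[OF f Ls] by simp

lemma bm_gysin_unt:
  assumes X: "X \<in> Obj D" "trm D X \<in> Spec D"
  shows "bm_gysin D B \<theta> (trm D X) (unt B (pt D)) = \<theta> (trm D X)"
proof -
  note t = trm_hom[OF X(1)]
  have "trm D (pt D) = Idn D (pt D)"
    using trm_unique[OF Idn_hom[OF pt_Obj]] by simp
  then show ?thesis
    unfolding bm_gysin_def homsetD(3)[OF t] using prd_unt[OF t theta_closed[OF X(2)]] by simp
qed

text \<open>
  Over \<open>X \<rightarrow> pt\<close> a generating cycle \<open>(h : V \<rightarrow> X; L\<^sub>1, \<dots>, L\<^sub>r)\<close> has \<open>V \<rightarrow> pt\<close> specialized, so that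
  \<open>[id\<^sub>V; L\<^sub>1, \<dots>, L\<^sub>r]\<close> is one of the elements on which the two transformations agree, and its image
  under \<open>h\<^sub>*\<close> is the generator.
\<close>
lemma bm_nat_trans_unique:
  assumes nat: "bm_nat_trans D (OM D) (om_theta D) B \<theta> \<gamma>" "bm_nat_trans D (OM D) (om_theta D) B \<theta> \<gamma>'"
    and eq: "\<And>X Ls. X \<in> Obj D \<Longrightarrow> trm D X \<in> Spec D \<Longrightarrow> set Ls \<subseteq> fib D X \<Longrightarrow>
      \<gamma> X (frag_of (cyc D (Idn D X) Ls)) = \<gamma>' X (frag_of (cyc D (Idn D X) Ls))"
    and X: "X \<in> Obj D" and \<alpha>: "\<alpha> \<in> carrier (bm_grp D (OM D) X)"
  shows "\<gamma> X \<alpha> = \<gamma>' X \<alpha>"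
proof (rule free_Abelian_group_hom_eqI[OF group_grp[OF trm_hom[OF X]]])
  note t = trm_hom[OF X]
  show "\<gamma> X \<in> hom (free_Abelian_group (om_generators D (trm D X))) (grp B (trm D X))"
    "\<gamma>' X \<in> hom (free_Abelian_group (om_generators D (trm D X))) (grp B (trm D X))"
    using nat X by (simp_all add: bm_nat_trans_def bm_grp_def OM_simps)
  show "Poly_Mapping.keys \<alpha> \<subseteq> om_generators D (trm D X)"
    using \<alpha> by (simp add: bm_grp_def OM_simps)
  fix c assume "c \<in> om_generators D (trm D X)"
  then obtain h Ls where h: "(h, Ls) \<in> om_cycles D (trm D X)" and c: "c = cyc D h Ls"
    by (rule om_generatorsE[OF t])
  note hD = om_cyclesD[OF t h]
  note V = homsetD(4)[OF hD(1)] and hX = homsetD(3)[OF hD(1)]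
  have th: "trm D X \<cdot> h = trm D (Dom D h)"
    by (rule trm_Cmp[OF hD(1)])
  define \<iota> where "\<iota> = frag_of (cyc D (Idn D (Dom D h)) Ls)"
  have tV: "trm D (Dom D h) \<in> Spec D"
    using hD(5) th by simp
  have \<iota>: "\<iota> \<in> carrier (bm_grp D (OM D) (Dom D h))"
    using om_generatorsI[OF om_cycles_Idn[OF trm_hom[OF V] tV hD(3)]]
    by (simp add: \<iota>_def bm_grp_def OM_simps)
  have push: "frag_of c = bm_push D (OM D) h \<iota>"
    using om_push_Idn[OF t h] by (simp add: bm_push_def OM_simps c \<iota>_def hX)
  have "\<delta> X (frag_of c) = bm_push D B h (\<delta> (Dom D h) \<iota>)"
    if "bm_nat_trans D (OM D) (om_theta D) B \<theta> \<delta>" for \<delta>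
    using that \<iota> hD(4) hX unfolding push bm_nat_trans_def by blast
  from this[OF nat(1)] this[OF nat(2)] show "\<gamma> X (frag_of c) = \<gamma>' X (frag_of c)"
    using eq[OF V tV hD(3)] by (simp add: \<iota>_def)
qed

lemma co_nat_trans_om_value:
  shows "co_nat_trans D (OM D) (om_theta D) B \<theta> (\<lambda>X. om_value (Idn D X))"
  unfolding co_nat_trans_def co_grp_def co_pull_def co_gysin_def co_ext_def OM_simps
proof (intro conjI ballI allI impI)
  fix X assume "X \<in> Obj D"
  then show "om_value (Idn D X) \<in> hom (free_Abelian_group (om_generators D (Idn D X))) (grp B (Idn D X))"
    using om_value_hom[OF Idn_hom] by blast
next
  fix f and \<alpha> :: "('m, 'l) cycle set \<Rightarrow>\<^sub>0 int"
  assume "f \<in> Arr D" and \<alpha>0: "\<alpha> \<in> carrier (free_Abelian_group (om_generators D (Idn D (Cod D f))))"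
  then have f: "f \<in> homset D (Dom D f) (Cod D f)"
    by (simp add: homset_def)
  note \<alpha> = \<alpha>0[unfolded carrier_free_Abelian_group_iff]
  show "om_value (Idn D (Dom D f)) (om_pull D (Idn D (Cod D f)) f (Idn D (Dom D f)) f \<alpha>)
      = pll B (Idn D (Cod D f)) f (Idn D (Dom D f)) f (om_value (Idn D (Cod D f)) \<alpha>)"
    by (rule om_value_pull[OF indep_Idn_vertical[OF f] \<alpha>])
next
  fix f and \<alpha> :: "('m, 'l) cycle set \<Rightarrow>\<^sub>0 int"
  assume fCS: "f \<in> Conf D \<inter> Spec D"
    and \<alpha>0: "\<alpha> \<in> carrier (free_Abelian_group (om_generators D (Idn D (Dom D f))))"
  then have fC: "f \<in> Conf D" and fS: "f \<in> Spec D"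
    by simp_all
  note \<alpha> = \<alpha>0[unfolded carrier_free_Abelian_group_iff]
  have f: "f \<in> homset D (Dom D f) (Cod D f)"
    using fS Spec_Arr by (auto simp: homset_def)
  note I = Idn_hom[OF homsetD(4)[OF f]] Idn_hom[OF homsetD(5)[OF f]]
  have th: "Poly_Mapping.keys (om_theta D f) \<subseteq> om_generators D f"
    using om_value_theta(1)[OF f fS] by simp
  have v: "om_value f (om_prod D (Idn D (Dom D f)) f \<alpha> (om_theta D f))
      = prd B (Idn D (Dom D f)) f (om_value (Idn D (Dom D f)) \<alpha>) (\<theta> f)"
    using om_value_prod[OF I(1) f \<alpha> th] unfolding Cmp_Idn[OF f] om_value_theta(2)[OF f fS] .
  have "Poly_Mapping.keys (om_prod D (Idn D (Dom D f)) f \<alpha> (om_theta D f)) \<subseteq> om_generators D (Idn D (Cod D f) \<cdot> f)"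
    using om_prod_closed[OF I(1) f \<alpha> th] unfolding Cmp_Idn[OF f] Idn_Cmp[OF f] .
  from om_value_push[OF f fC I(2) this]
  show "om_value (Idn D (Cod D f))
        (om_push D f (Idn D (Cod D f)) (om_prod D (Idn D (Dom D f)) f \<alpha> (om_theta D f)))
      = psh B f (Idn D (Cod D f)) (prd B (Idn D (Dom D f)) f (om_value (Idn D (Dom D f)) \<alpha>) (\<theta> f))"
    unfolding Idn_Cmp[OF f] v .
next
  fix p q and \<alpha> \<beta> :: "('m, 'l) cycle set \<Rightarrow>\<^sub>0 int"
  assume pq: "is_product D p q"
    and \<alpha>0: "\<alpha> \<in> carrier (free_Abelian_group (om_generators D (Idn D (Cod D p))))"
    and \<beta>0: "\<beta> \<in> carrier (free_Abelian_group (om_generators D (Idn D (Cod D q))))"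
  note \<alpha> = \<alpha>0[unfolded carrier_free_Abelian_group_iff] and \<beta> = \<beta>0[unfolded carrier_free_Abelian_group_iff]
  note sq = fibre_squareD[OF pq[unfolded is_product_def]]
  have p: "p \<in> homset D (Dom D p) (Cod D p)" and q: "q \<in> homset D (Dom D p) (Cod D q)"
    using sq by (simp_all add: homset_def)
  have dq: "Dom D q = Dom D p"
    using sq by simp
  note I = Idn_hom[OF homsetD(4)[OF p]]
  note ip = indep_Idn_vertical[OF p] and iq = indep_Idn_vertical[OF q]
  show "om_value (Idn D (Dom D p)) (om_prod D (Idn D (Dom D p)) (Idn D (Dom D p))
        (om_pull D (Idn D (Cod D p)) p (Idn D (Dom D p)) p \<alpha>)
        (om_pull D (Idn D (Cod D q)) q (Idn D (Dom D q)) q \<beta>))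
      = prd B (Idn D (Dom D p)) (Idn D (Dom D p))
          (pll B (Idn D (Cod D p)) p (Idn D (Dom D p)) p (om_value (Idn D (Cod D p)) \<alpha>))
          (pll B (Idn D (Cod D q)) q (Idn D (Dom D q)) q (om_value (Idn D (Cod D q)) \<beta>))"
    using om_value_prod[OF I I om_pull_closed[OF ip \<alpha>] om_pull_closed[OF iq \<beta>]]
    unfolding dq Idn_Cmp[OF I] om_value_pull[OF ip \<alpha>] om_value_pull[OF iq \<beta>] .
next
  fix X L and \<alpha> :: "('m, 'l) cycle set \<Rightarrow>\<^sub>0 int"
  assume "X \<in> Obj D" "L \<in> fib D X" "\<alpha> \<in> carrier (free_Abelian_group (om_generators D (Idn D X)))"
  then show "om_value (Idn D X) (om_ori D (Idn D X) L \<alpha>) = ori B (Idn D X) L (om_value (Idn D X) \<alpha>)"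
    using om_value_ori[OF Idn_hom] by simp
qed

text \<open>
  Over an identity a generating cycle has its arrow \<open>h\<close> both confined and specialized, hence is
  \<open>h\<^sub>!\<close> of a cycle on which the two transformations agree.
\<close>
lemma co_nat_trans_unique:
  assumes nat: "co_nat_trans D (OM D) (om_theta D) B \<theta> \<gamma>" "co_nat_trans D (OM D) (om_theta D) B \<theta> \<gamma>'"
    and eq: "\<And>X Ls. X \<in> Obj D \<Longrightarrow> set Ls \<subseteq> fib D X \<Longrightarrow>
      \<gamma> X (frag_of (cyc D (Idn D X) Ls)) = \<gamma>' X (frag_of (cyc D (Idn D X) Ls))"
    and X: "X \<in> Obj D" and \<alpha>: "\<alpha> \<in> carrier (co_grp D (OM D) X)"
  shows "\<gamma> X \<alpha> = \<gamma>' X \<alpha>"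
proof (rule free_Abelian_group_hom_eqI[OF group_grp[OF Idn_hom[OF X]]])
  note t = Idn_hom[OF X]
  show "\<gamma> X \<in> hom (free_Abelian_group (om_generators D (Idn D X))) (grp B (Idn D X))"
    "\<gamma>' X \<in> hom (free_Abelian_group (om_generators D (Idn D X))) (grp B (Idn D X))"
    using nat X by (simp_all add: co_nat_trans_def co_grp_def OM_simps)
  show "Poly_Mapping.keys \<alpha> \<subseteq> om_generators D (Idn D X)"
    using \<alpha> by (simp add: co_grp_def OM_simps)
  fix c assume "c \<in> om_generators D (Idn D X)"
  then obtain h Ls where h: "(h, Ls) \<in> om_cycles D (Idn D X)" and c: "c = cyc D h Ls"
    by (rule om_generatorsE[OF t])
  note hD = om_cyclesD[OF t h]
  note V = homsetD(4)[OF hD(1)] and hX = homsetD(3)[OF hD(1)]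
  have hCS: "h \<in> Conf D \<inter> Spec D"
    using hD(4,5) Idn_Cmp[OF hD(1)] by simp
  define \<iota> where "\<iota> = frag_of (cyc D (Idn D (Dom D h)) Ls)"
  have \<iota>: "\<iota> \<in> carrier (co_grp D (OM D) (Dom D h))"
    using om_generatorsI[OF om_cycles_Idn[OF Idn_hom[OF V] Spec_Idn[OF V] hD(3)]]
    by (simp add: \<iota>_def co_grp_def OM_simps)
  have gysin: "frag_of c = co_gysin D (OM D) (om_theta D) h \<iota>"
    using om_push_Idn[OF t h] om_prod_theta_Idn[OF hD(1,3)]
    by (simp add: co_gysin_def OM_simps c \<iota>_def hX)
  have "\<delta> X (frag_of c) = co_gysin D B \<theta> h (\<delta> (Dom D h) \<iota>)"
    if "co_nat_trans D (OM D) (om_theta D) B \<theta> \<delta>" for \<delta>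
    using that \<iota> hCS hX unfolding gysin co_nat_trans_def by blast
  from this[OF nat(1)] this[OF nat(2)] show "\<gamma> X (frag_of c) = \<gamma>' X (frag_of c)"
    using eq[OF V hD(3)] by (simp add: \<iota>_def)
qed

end

theorem corollary4p8:
  fixes D :: "('o, 'm, 'l, 'e) bicat"
    and OBT :: "('o, 'm, 'l, 'b) oriented_bivariant set"
    and \<Theta> :: "('o, 'm, 'l, 'b) oriented_bivariant \<Rightarrow> 'm \<Rightarrow> 'b"
  assumes "bivariant_data D"
    and "exterior_squares_independent D"
    and "additive_data D"
    and "\<forall>OB \<in> OBT. oriented_bivariant_theory D OB \<and> additive_theory D OB (\<Theta> OB)"
    and "\<forall>OB \<in> OBT. nice_canonical_orientation D OB (\<Theta> OB)"
  shows "\<forall>OB \<in> OBT.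
    (let
      bm = (\<lambda>\<gamma>. bm_nat_trans D (OM D) (om_theta D) OB (\<Theta> OB) \<gamma> \<and>
        (\<forall>X \<in> Obj D. \<forall>Ls. trm D X \<in> Spec D \<and> set Ls \<subseteq> fib D X \<longrightarrow>
          \<gamma> X (frag_of (cyc D (Idn D X) Ls))
            = foldr (ori OB (trm D X)) Ls
                (bm_gysin D OB (\<Theta> OB) (trm D X) (unt OB (pt D)))));
      co = (\<lambda>\<gamma>. co_nat_trans D (OM D) (om_theta D) OB (\<Theta> OB) \<gamma> \<and>
        (\<forall>X \<in> Obj D. \<forall>Ls. set Ls \<subseteq> fib D X \<longrightarrow>
          \<gamma> X (frag_of (cyc D (Idn D X) Ls)) = foldr (ori OB (Idn D X)) Ls (unt OB X)))
    in
      ((\<exists>\<gamma>. bm \<gamma>) \<and>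
       (\<forall>\<gamma> \<gamma>'. bm \<gamma> \<and> bm \<gamma>' \<longrightarrow>
          (\<forall>X \<in> Obj D. \<forall>\<alpha> \<in> carrier (bm_grp D (OM D) X). \<gamma> X \<alpha> = \<gamma>' X \<alpha>))) \<and>
      ((\<exists>\<gamma>. co \<gamma>) \<and>
       (\<forall>\<gamma> \<gamma>'. co \<gamma> \<and> co \<gamma>' \<longrightarrow>
          (\<forall>X \<in> Obj D. \<forall>\<alpha> \<in> carrier (co_grp D (OM D) X). \<gamma> X \<alpha> = \<gamma>' X \<alpha>))))"
  unfolding Let_def
proof (intro ballI conjI allI impI)
  fix OB assume OB: "OB \<in> OBT"
  interpret oriented_transformation D OB "\<Theta> OB"
  proof (intro oriented_transformation.intro oriented_transformation_axioms.intro)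
    show "oriented_bivariant_theory D OB" "nice_canonical_orientation D OB (\<Theta> OB)"
      using assms(4,5) OB by blast+
    show "indep D f g f' g'" if "fibre_square D f g f' g'" "f \<in> Conf D \<or> g \<in> Conf D" for f g f' g'
      using assms(3) that unfolding additive_data_def by blast
  qed
  show "\<exists>\<gamma>. bm_nat_trans D (OM D) (om_theta D) OB (\<Theta> OB) \<gamma> \<and>
      (\<forall>X \<in> Obj D. \<forall>Ls. trm D X \<in> Spec D \<and> set Ls \<subseteq> fib D X \<longrightarrow>
        \<gamma> X (frag_of (cyc D (Idn D X) Ls))
          = foldr (ori OB (trm D X)) Ls (bm_gysin D OB (\<Theta> OB) (trm D X) (unt OB (pt D))))"
    using bm_nat_trans_om_value[OF assms(2)] om_value_Idn_cycle[OF trm_hom] bm_gysin_unt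
    by (intro exI[of _ "\<lambda>X. om_value (trm D X)"]) simp
  show "\<exists>\<gamma>. co_nat_trans D (OM D) (om_theta D) OB (\<Theta> OB) \<gamma> \<and>
      (\<forall>X \<in> Obj D. \<forall>Ls. set Ls \<subseteq> fib D X \<longrightarrow>
        \<gamma> X (frag_of (cyc D (Idn D X) Ls)) = foldr (ori OB (Idn D X)) Ls (unt OB X))"
    using co_nat_trans_om_value om_value_Idn_cycle[OF Idn_hom] Spec_Idn theta_Idn
    by (intro exI[of _ "\<lambda>X. om_value (Idn D X)"]) simp
  fix \<gamma> \<gamma>' :: "'o \<Rightarrow> (('m, 'l) cycle set \<Rightarrow>\<^sub>0 int) \<Rightarrow> 'b" and X \<alpha>
  assume X: "X \<in> Obj D"
  show "\<gamma> X \<alpha> = \<gamma>' X \<alpha>"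
    if bm: "(bm_nat_trans D (OM D) (om_theta D) OB (\<Theta> OB) \<gamma> \<and>
        (\<forall>X \<in> Obj D. \<forall>Ls. trm D X \<in> Spec D \<and> set Ls \<subseteq> fib D X \<longrightarrow>
          \<gamma> X (frag_of (cyc D (Idn D X) Ls))
            = foldr (ori OB (trm D X)) Ls (bm_gysin D OB (\<Theta> OB) (trm D X) (unt OB (pt D))))) \<and>
      (bm_nat_trans D (OM D) (om_theta D) OB (\<Theta> OB) \<gamma>' \<and>
        (\<forall>X \<in> Obj D. \<forall>Ls. trm D X \<in> Spec D \<and> set Ls \<subseteq> fib D X \<longrightarrow>
          \<gamma>' X (frag_of (cyc D (Idn D X) Ls))
            = foldr (ori OB (trm D X)) Ls (bm_gysin D OB (\<Theta> OB) (trm D X) (unt OB (pt D)))))"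
      and \<alpha>: "\<alpha> \<in> carrier (bm_grp D (OM D) X)"
  proof (rule bm_nat_trans_unique[OF _ _ _ X \<alpha>])
    show "bm_nat_trans D (OM D) (om_theta D) OB (\<Theta> OB) \<gamma>" "bm_nat_trans D (OM D) (om_theta D) OB (\<Theta> OB) \<gamma>'"
      using bm by blast+
  qed (use bm in simp)
  show "\<gamma> X \<alpha> = \<gamma>' X \<alpha>"
    if co: "(co_nat_trans D (OM D) (om_theta D) OB (\<Theta> OB) \<gamma> \<and>
        (\<forall>X \<in> Obj D. \<forall>Ls. set Ls \<subseteq> fib D X \<longrightarrow>
          \<gamma> X (frag_of (cyc D (Idn D X) Ls)) = foldr (ori OB (Idn D X)) Ls (unt OB X))) \<and>
      (co_nat_trans D (OM D) (om_theta D) OB (\<Theta> OB) \<gamma>' \<and>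
        (\<forall>X \<in> Obj D. \<forall>Ls. set Ls \<subseteq> fib D X \<longrightarrow>
          \<gamma>' X (frag_of (cyc D (Idn D X) Ls)) = foldr (ori OB (Idn D X)) Ls (unt OB X)))"
      and \<alpha>: "\<alpha> \<in> carrier (co_grp D (OM D) X)"
  proof (rule co_nat_trans_unique[OF _ _ _ X \<alpha>])
    show "co_nat_trans D (OM D) (om_theta D) OB (\<Theta> OB) \<gamma>" "co_nat_trans D (OM D) (om_theta D) OB (\<Theta> OB) \<gamma>'"
      using co by blast+
  qed (use co in simp)
qed

end
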